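(* In the mixture Cramér–Lundberg model described in the context, for each fixed $n\in\mathbb{N}$, $n\ge1$ (and fixed number $\kappa\ge2$ of simulations), the variance of the Pollaczek–Khinchine-based control variate estimator $\hat\varphi^{\circ,n}_\kappa(u)$ satisfies $$\mathrm{Var}\big(\hat\varphi^{\circ,n}_\kappa(u)\big)\sim\rho^{\,n+3}\,\frac{1+n(1-\rho)}{1-\rho}\cdot\frac{\epsilon\theta}{\rho}\cdot\frac{\overline{F_h^e}(u)}{\kappa}\qquad\text{as }u\to\infty,$$ and $$\frac{\mathrm{Var}\big(\hat\varphi^{\circ,n}_\kappa(u)\big)}{\mathrm{Var}\big(\hat z^{\circ}_\kappa(u)\big)}\to\rho^{\,n-1}\,\frac{1+n(1-\rho)}{1+(1-\rho)}\qquad\text{as }u\to\infty.$$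
   Context: Write $\overline F=1-F$ for tails; $f(u)\sim g(u)$ means $f(u)/g(u)\to1$. A distribution function $F$ on $[0,\infty)$ with $\overline F>0$ is subexponential if $\overline{F^{*n}}(u)\sim n\overline F(u)$ as $u\to\infty$ for every $n\in\mathbb{N}$ ($F^{*n}$ is the $n$-fold convolution). A phase-type distribution is the law of the absorption time of a finite-state Markov jump process with all states but one transient and the remaining one absorbing. Model. Claims arrive according to a Poisson process with rate $\lambda>0$, premium rate is $1$, and claim sizes are i.i.d. copies of a random variable $U$, independent of the arrivals, with distribution function $G=(1-\epsilon)F_p+\epsilon F_h$, where $\epsilon\in(0,1)$, $F_p$ is the phase-type distribution function of a random variable $B$ with finite mean $\mu_B$, and $F_h$ is the subexponential distribution function of a random variable $C$ with finite mean $\mu_C$. Put $\theta=\lambda\mu_C$ and $\rho=\lambda\,\mathbb{E}U=(1-\epsilon)\lambda\mu_B+\epsilon\theta$, and assume the net profit condition $\rho<1$. Stationary excess distributions: $F_h^e(u)=\frac1{\mu_C}\int_0^u(1-F_h(x))\,dx$ and $G^e(u)=\frac1{\mathbb{E}U}\int_0^u(1-G(x))\,dx$. It is assumed that $F_h^e$ is subexponential. Let $U^e_1,U^e_2,\dots$ be i.i.d. with distribution function $G^e$, and let $N^\circ$ be geometric, independent of $(U^e_k)$, with $\mathbb{P}(N^\circ=k)=(1-\rho)\rho^k$, $k=0,1,2,\dots$. Define $$V^\circ=\sum_{k=1}^{N^\circ+2}U^e_k,\qquad V^\circ_n=\max\{U^e_1,\dots,U^e_{N^\circ+2}\}\,\mathbf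 1_{\{N^\circ\le n-2\}},$$ $$Z^\circ(u)=\rho^2\,\mathbf 1_{\{V^\circ>u\}},\qquad W^\circ_n(u)=\rho^2\,\mathbf 1_{\{V^\circ_n>u\}},\qquad \varphi^\circ_n(u)=\mathbb{E}\,W^\circ_n(u).$$ Let $(Z^{\circ,(i)}(u),W^{\circ,(i)}(u))$, $i=1,\dots,\kappa$, be i.i.d. copies of the pair $(Z^\circ(u),W^\circ_n(u))$. Put $$\hat z^\circ_\kappa(u)=\frac1\kappa\sum_{i=1}^\kappa Z^{\circ,(i)}(u),\quad \hat w^\circ_\kappa(u)=\frac1\kappa\sum_{i=1}^\kappa W^{\circ,(i)}(u),\quad \hat\alpha^\circ_\kappa=-\frac{\sum_{i=1}^\kappa\big(Z^{\circ,(i)}(u)-\hat z^\circ_\kappa(u)\big)\big(W^{\circ,(i)}(u)-\hat w^\circ_\kappa(u)\big)}{\sum_{i=1}^\kappa\big(W^{\circ,(i)}(u)-\hat w^\circ_\kappa(u)\big)^2},$$ with $\hat\alpha^\circ_\kappa=0$ when the denominator vanishes, and define the estimator $$\hat\varphi^{\circ,n}_\kappa(u)=\hat z^\circ_\kappa(u)+\hat\alpha^\circ_\kappa\big(\hat w^\circ_\kappa(u)-\varphi^\circ_n(u)\big).$$ *)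

theory Defs
  imports "HOL-Probability.Probability" "HOL-Library.Landau_Symbols"
begin

subsection \<open>Distribution functions and subexponentiality\<close>

definition df_nonneg :: "(real \<Rightarrow> real) \<Rightarrow> bool" where
  "df_nonneg F \<longleftrightarrow> mono F \<and> (\<forall>x. continuous (at_right x) F) \<and>
     (\<forall>x<0. F x = 0) \<and> (F \<longlongrightarrow> 1) at_top"

definition conv_power :: "nat \<Rightarrow> (real \<Rightarrow> real) \<Rightarrow> real \<Rightarrow> real" where
  "conv_power n F = cdf (((\<lambda>D. convolution (interval_measure F) D) ^^ n) (return borel 0))"

definition subexponential :: "(real \<Rightarrow> real) \<Rightarrow> bool" where
  "subexponential F \<longleftrightarrow> df_nonneg F \<and> (\<forall>u. 1 - F u > 0) \<and>
     (\<forall>n\<ge>1. (\<lambda>u. 1 - conv_power n F u) \<sim>[at_top] (\<lambda>u. real n * (1 - F u)))"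

text \<open>The argument \<open>m\<close> is the mean of the distribution function \<open>F\<close> on the half-line.\<close>

definition excess_df :: "real \<Rightarrow> (real \<Rightarrow> real) \<Rightarrow> real \<Rightarrow> real" where
  "excess_df m F u = (if u < 0 then 0 else (1 / m) * (LBINT x:{0..u}. 1 - F x))"


subsection \<open>Markov jump processes and phase-type distributions\<close>

text \<open>A time-homogeneous Markov jump process on a finite state space \<open>S\<close>, given as the family
  of laws \<open>P i\<close> under which it starts in \<open>i\<close>, all on one measurable space.  Paths are
  right-continuous with left limits for the discrete topology, that is, piecewise constant with
  finitely many jumps in bounded time intervals.\<close>

locale markov_jump_process =
  fixes S :: "'s set" and P :: "'s \<Rightarrow> 'w measure" and J :: "real \<Rightarrow> 'w \<Rightarrow> 's"
  assumes finite_states: "finite S"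
    and prob_space_P: "\<And>i. i \<in> S \<Longrightarrow> prob_space (P i)"
    and sets_P: "\<And>i j. i \<in> S \<Longrightarrow> j \<in> S \<Longrightarrow> sets (P i) = sets (P j)"
    and measurable_J: "\<And>i t. i \<in> S \<Longrightarrow> 0 \<le> t \<Longrightarrow> J t \<in> measurable (P i) (count_space S)"
    and start: "\<And>i. i \<in> S \<Longrightarrow> AE \<omega> in P i. J 0 \<omega> = i"
    and right_continuous: "\<And>i \<omega> t. i \<in> S \<Longrightarrow> \<omega> \<in> space (P i) \<Longrightarrow> 0 \<le> t \<Longrightarrow>
          eventually (\<lambda>s. J s \<omega> = J t \<omega>) (at_right t)"
    and left_limits: "\<And>i \<omega> t. i \<in> S \<Longrightarrow> \<omega> \<in> space (P i) \<Longrightarrow> 0 < t \<Longrightarrow>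
          \<exists>j. eventually (\<lambda>s. J s \<omega> = j) (at_left t)"
    and markov: "\<And>i (m :: nat) (t :: nat \<Rightarrow> real) x h j.
          i \<in> S \<Longrightarrow> 0 \<le> t 0 \<Longrightarrow> mono_on {..m} t \<Longrightarrow> x ` {..m} \<subseteq> S \<Longrightarrow> 0 \<le> h \<Longrightarrow> j \<in> S \<Longrightarrow>
          measure (P i) {\<omega> \<in> space (P i). (\<forall>k\<le>m. J (t k) \<omega> = x k) \<and> J (t m + h) \<omega> = j} =
          measure (P i) {\<omega> \<in> space (P i). \<forall>k\<le>m. J (t k) \<omega> = x k} *
          measure (P (x m)) {\<omega> \<in> space (P (x m)). J h \<omega> = j}"
begin

definition absorbing :: "'s \<Rightarrow> bool" where
  "absorbing i \<longleftrightarrow> (AE \<omega> in P i. \<forall>t\<ge>0. J t \<omega> = i)"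

definition transient :: "'s \<Rightarrow> bool" where
  "transient i \<longleftrightarrow> (AE \<omega> in P i. bounded {t. 0 \<le> t \<and> J t \<omega> = i})"

end

locale absorbing_jump_process = markov_jump_process S P J
  for S :: "'s set" and P :: "'s \<Rightarrow> 'w measure" and J :: "real \<Rightarrow> 'w \<Rightarrow> 's" +
  fixes \<Delta> :: 's
  assumes absorbing_state: "\<Delta> \<in> S" "absorbing \<Delta>"
    and transient_states: "\<And>i. i \<in> S - {\<Delta>} \<Longrightarrow> transient i"

text \<open>The time is \<open>\<infinity>\<close> on paths that never reach \<open>\<Delta>\<close>.\<close>

definition absorption_time :: "(real \<Rightarrow> 'w \<Rightarrow> 's) \<Rightarrow> 's \<Rightarrow> 'w \<Rightarrow> ereal" where
  "absorption_time J \<Delta> \<omega> = (INF t\<in>{t. 0 \<le> t \<and> J t \<omega> = \<Delta>}. ereal t)"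

text \<open>\<open>F\<close> is the distribution function of the absorption time of the process \<open>J\<close> started from
  the initial distribution \<open>\<alpha>\<close>.\<close>

definition phase_type ::
    "'s set \<Rightarrow> ('s \<Rightarrow> 'w measure) \<Rightarrow> (real \<Rightarrow> 'w \<Rightarrow> 's) \<Rightarrow> 's \<Rightarrow> 's pmf \<Rightarrow> (real \<Rightarrow> real) \<Rightarrow> bool" where
  "phase_type S P J \<Delta> \<alpha> F \<longleftrightarrow>
     absorbing_jump_process S P J \<Delta> \<and> set_pmf \<alpha> \<subseteq> S \<and>
     (\<forall>u. F u = (\<Sum>i\<in>S. pmf \<alpha> i *
        measure (P i) {\<omega> \<in> space (P i). absorption_time J \<Delta> \<omega> \<le> ereal u}))"


subsection \<open>The claim process\<close>

text \<open>Unlike \<open>indep_var\<close>, this allows \<open>X\<close> and \<open>Y\<close> to take values in different types.\<close>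

definition indep_rv ::
    "'a measure \<Rightarrow> 'x measure \<Rightarrow> ('a \<Rightarrow> 'x) \<Rightarrow> 'y measure \<Rightarrow> ('a \<Rightarrow> 'y) \<Rightarrow> bool" where
  "indep_rv M MX X MY Y \<longleftrightarrow> X \<in> measurable M MX \<and> Y \<in> measurable M MY \<and>
     prob_space.indep_set M {X -` E \<inter> space M |E. E \<in> sets MX} {Y -` E \<inter> space M |E. E \<in> sets MY}"

locale poisson_process = prob_space M for M :: "'a measure" +
  fixes rate :: real and A :: "real \<Rightarrow> 'a \<Rightarrow> nat"
  assumes rate_pos: "rate > 0"
    and measurable_A: "\<And>t. 0 \<le> t \<Longrightarrow> A t \<in> measurable M (count_space UNIV)"
    and zero: "\<And>\<omega>. \<omega> \<in> space M \<Longrightarrow> A 0 \<omega> = 0"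
    and paths_mono: "\<And>\<omega>. \<omega> \<in> space M \<Longrightarrow> mono_on {0..} (\<lambda>t. A t \<omega>)"
    and paths_right_continuous: "\<And>\<omega> t. \<omega> \<in> space M \<Longrightarrow> 0 \<le> t \<Longrightarrow>
          eventually (\<lambda>s. A s \<omega> = A t \<omega>) (at_right t)"
    and independent_increments: "\<And>(m :: nat) (t :: nat \<Rightarrow> real). 0 \<le> t 0 \<Longrightarrow> mono_on {..m} t \<Longrightarrow>
          indep_vars (\<lambda>_. count_space UNIV) (\<lambda>k \<omega>. A (t (Suc k)) \<omega> - A (t k) \<omega>) {..<m}"
    and poisson_increments: "\<And>s t k. 0 \<le> s \<Longrightarrow> s < t \<Longrightarrow>
          prob {\<omega> \<in> space M. A t \<omega> - A s \<omega> = k} = pmf (poisson_pmf (rate * (t - s))) k"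

locale compound_poisson_claims = poisson_process M rate A
  for M :: "'a measure" and rate :: real and A :: "real \<Rightarrow> 'a \<Rightarrow> nat" +
  fixes U :: "nat \<Rightarrow> 'a \<Rightarrow> real" and G :: "real \<Rightarrow> real"
  assumes claims_indep: "indep_vars (\<lambda>_. borel) U UNIV"
    and claims_df: "\<And>k. cdf (distr M borel (U k)) = G"
    and arrivals_claims_indep:
      "indep_rv M (PiM {0..} (\<lambda>_. count_space UNIV)) (\<lambda>\<omega>. \<lambda>t\<in>{0..}. A t \<omega>)
                  (PiM UNIV (\<lambda>_. borel)) (\<lambda>\<omega> k. U k \<omega>)"


subsection \<open>The Pollaczek--Khinchine control variate\<close>

text \<open>\<open>Ue k\<close> is only used for \<open>k \<ge> 1\<close>.\<close>

locale pk_variables = prob_space R for R :: "'b measure" +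
  fixes \<rho> :: real and Ge :: "real \<Rightarrow> real" and N :: "'b \<Rightarrow> nat" and Ue :: "nat \<Rightarrow> 'b \<Rightarrow> real"
  assumes excess_indep: "indep_vars (\<lambda>_. borel) Ue {1..}"
    and excess_distribution: "\<And>k. k \<ge> 1 \<Longrightarrow> cdf (distr R borel (Ue k)) = Ge"
    and measurable_N: "N \<in> measurable R (count_space UNIV)"
    and geometric: "\<And>k. prob {\<omega> \<in> space R. N \<omega> = k} = (1 - \<rho>) * \<rho> ^ k"
    and count_excess_indep:
      "indep_rv R (count_space UNIV) N (PiM {1..} (\<lambda>_. borel)) (\<lambda>\<omega>. \<lambda>k\<in>{1..}. Ue k \<omega>)"

definition pk_V :: "('b \<Rightarrow> nat) \<Rightarrow> (nat \<Rightarrow> 'b \<Rightarrow> real) \<Rightarrow> 'b \<Rightarrow> real" where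
  "pk_V N Ue \<omega> = (\<Sum>k = 1..N \<omega> + 2. Ue k \<omega>)"

definition pk_Vn :: "('b \<Rightarrow> nat) \<Rightarrow> (nat \<Rightarrow> 'b \<Rightarrow> real) \<Rightarrow> nat \<Rightarrow> 'b \<Rightarrow> real" where
  "pk_Vn N Ue n \<omega> = Max ((\<lambda>k. Ue k \<omega>) ` {1..N \<omega> + 2}) * of_bool (int (N \<omega>) \<le> int n - 2)"

definition pk_Z :: "real \<Rightarrow> ('b \<Rightarrow> nat) \<Rightarrow> (nat \<Rightarrow> 'b \<Rightarrow> real) \<Rightarrow> real \<Rightarrow> 'b \<Rightarrow> real" where
  "pk_Z \<rho> N Ue u \<omega> = \<rho>\<^sup>2 * of_bool (pk_V N Ue \<omega> > u)"

definition pk_W :: "real \<Rightarrow> ('b \<Rightarrow> nat) \<Rightarrow> (nat \<Rightarrow> 'b \<Rightarrow> real) \<Rightarrow> nat \<Rightarrow> real \<Rightarrow> 'b \<Rightarrow> real" where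
  "pk_W \<rho> N Ue n u \<omega> = \<rho>\<^sup>2 * of_bool (pk_Vn N Ue n \<omega> > u)"

definition sample_mean :: "nat \<Rightarrow> (nat \<Rightarrow> real) \<Rightarrow> real" where
  "sample_mean \<kappa> z = (1 / real \<kappa>) * (\<Sum>i<\<kappa>. z i)"

definition cv_coeff :: "nat \<Rightarrow> (nat \<Rightarrow> real) \<Rightarrow> (nat \<Rightarrow> real) \<Rightarrow> real" where
  "cv_coeff \<kappa> z w =
     (let d = (\<Sum>i<\<kappa>. (w i - sample_mean \<kappa> w)\<^sup>2) in
      if d = 0 then 0
      else - ((\<Sum>i<\<kappa>. (z i - sample_mean \<kappa> z) * (w i - sample_mean \<kappa> w)) / d))"

definition cv_estimator :: "nat \<Rightarrow> real \<Rightarrow> (nat \<Rightarrow> real) \<Rightarrow> (nat \<Rightarrow> real) \<Rightarrow> real" where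
  "cv_estimator \<kappa> \<phi> z w = sample_mean \<kappa> z + cv_coeff \<kappa> z w * (sample_mean \<kappa> w - \<phi>)"

definition iid_pair_copies ::
    "'q measure \<Rightarrow> nat \<Rightarrow> (nat \<Rightarrow> 'q \<Rightarrow> real) \<Rightarrow> (nat \<Rightarrow> 'q \<Rightarrow> real) \<Rightarrow>
     'b measure \<Rightarrow> ('b \<Rightarrow> real) \<Rightarrow> ('b \<Rightarrow> real) \<Rightarrow> bool" where
  "iid_pair_copies Q \<kappa> Zs Ws R Z W \<longleftrightarrow>
     prob_space.indep_vars Q (\<lambda>_. borel \<Otimes>\<^sub>M borel) (\<lambda>i \<omega>. (Zs i \<omega>, Ws i \<omega>)) {..<\<kappa>} \<and>
     (\<forall>i<\<kappa>. distr Q (borel \<Otimes>\<^sub>M borel) (\<lambda>\<omega>. (Zs i \<omega>, Ws i \<omega>)) =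
            distr R (borel \<Otimes>\<^sub>M borel) (\<lambda>\<omega>. (Z \<omega>, W \<omega>)))"

end

theory Submission
  imports Defs
begin

text \<open>
  For large \<open>u\<close> the sample is most likely to contain no realization with \<open>V > u\<close>, and then the estimator
  vanishes. Exactly one such realization occurs with probability about \<open>\<kappa> \<cdot> P(V > u)\<close>. If \<open>V\<^sub>n > u\<close> holds
  for it too, then the estimated coefficient is \<open>-1\<close> and the estimator equals \<open>\<phi>\<^sub>n(u)\<close>, which is negligible;
  otherwise the coefficient is \<open>0\<close> and the estimator equals \<open>\<rho>\<^sup>2 / \<kappa>\<close>. For fixed \<open>\<kappa>\<close> the coefficient is
  bounded, so two or more such realizations only contribute \<open>O(P(V > u)\<^sup>2)\<close>, and the variance is
  \<open>\<rho>\<^sup>4 / \<kappa> \<cdot> (P(V > u) - P(V\<^sub>n > u)) + O(P(V > u)\<^sup>2)\<close>. The same estimate without control variate handles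
  the crude estimator.

  The phase-type part has an exponential tail, so the excess distribution of the mixture is tail
  equivalent to the subexponential \<open>F\<^sub>h\<^sup>e\<close> and hence itself subexponential. Both probabilities are then
  sums over the geometric variable in which each excess variable contributes one copy of its tail;
  Kesten's bound justifies the interchange of limit and sum for \<open>V\<close>.
\<close>

subsection \<open>Tails of distributions on the half-line\<close>

text \<open>The obstacle is the estimated coefficient, a quotient of dependent random sums whose
  moments are hard to reach. Since the samples only take the values 0 and
  \<open>\<rho>\<^sup>2\<close>, counting the nonzero ones replaces any analysis of the quotient.
  The squared mean is also O(P(V > u)^2), so the second moment carries the leading term; division by
  a tail of order P(V > u) removes the errors, provided that their constant does not depend on u.

  The normalising tail is that of G^e. Given N = k, the events V > u and V_n > u are each worth k +
  2 such tails, the second one only for k at most n - 2. Their difference is the remainder from k =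
  n - 1 on of the series of (1 - \<rho>) \<rho>^k (k + 2), that is \<rho>^(n-1) (1 + n (1 - \<rho>))
  / (1 - \<rho>). The exponent n + 3 collects this power and \<rho>^4, the square of a nonzero
  sample; \<epsilon> \<theta> / \<rho> is the limit of the tail of G^e over the tail of
  F_h^e.\<close>

definition tail :: "real measure \<Rightarrow> real \<Rightarrow> real" where
  "tail D u = measure D {u<..}"

locale half_line_distribution = real_distribution +
  assumes negative_null: "measure M {..<0} = 0"
begin

lemma tail_eq_cdf: "tail M u = 1 - cdf M u"
proof -
  have "cdf M u + tail M u = measure M ({..u} \<union> {u<..})"
    unfolding cdf_def tail_def by (rule finite_measure_Union[symmetric]) auto
  also have "{..u} \<union> {u<..} = space M"
    by auto
  finally show ?thesis
    using prob_space by simp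
qed

lemma tail_mono: "x \<le> y \<Longrightarrow> tail M y \<le> tail M x"
  unfolding tail_eq_cdf using cdf_nondecreasing by auto

lemma tail_nonneg [simp]: "0 \<le> tail M u"
  by (simp add: tail_def)

lemma tail_le_1 [simp]: "tail M u \<le> 1"
  by (simp add: tail_def)

lemma tail_negative: "u < 0 \<Longrightarrow> tail M u = 1"
proof -
  assume "u < 0"
  then have "cdf M u \<le> measure M {..<0}"
    unfolding cdf_def by (intro finite_measure_mono) auto
  then show ?thesis
    using negative_null cdf_nonneg[of u] by (simp add: tail_eq_cdf)
qed

lemma AE_nonneg: "AE x in M. 0 \<le> x"
proof -
  have "{x \<in> space M. \<not> 0 \<le> x} = {..<0}"
    by auto
  then show ?thesis
    using negative_null by (subst AE_iff_measurable[of "{..<0}"]) (auto simp: emeasure_eq_measure)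
qed

lemma measurable_tail [measurable]: "tail M \<in> borel_measurable borel"
proof -
  have "mono (\<lambda>u. cdf M u)"
    by (simp add: mono_def cdf_nondecreasing)
  then have [measurable]: "cdf M \<in> borel_measurable borel"
    by (rule borel_measurable_mono)
  have "tail M = (\<lambda>u. 1 - cdf M u)"
    by (simp add: fun_eq_iff tail_eq_cdf)
  then show ?thesis
    by simp
qed

lemma tail_tendsto_0: "(tail M \<longlongrightarrow> 0) at_top"
proof -
  have "((\<lambda>u. 1 - cdf M u) \<longlongrightarrow> 1 - 1) at_top"
    by (intro tendsto_intros cdf_lim_at_top_prob)
  then show ?thesis
    by (simp add: tail_eq_cdf[abs_def])
qed

end

section \<open>Convolution tails and their comparison\<close>

lemma tail_convolution:
  assumes "half_line_distribution A" "half_line_distribution E"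
  shows "tail (A \<star> E) u = (\<integral>x. tail E (u - x) \<partial>A)"
proof -
  interpret A: half_line_distribution A by fact
  interpret E: half_line_distribution E by fact
  have [measurable_cong]: "sets A = sets borel" "sets E = sets borel"
    using A.M_is_borel E.M_is_borel by auto
  have "emeasure (A \<star> E) {u<..} = (\<integral>\<^sup>+x. emeasure E {a. a + x \<in> {u<..}} \<partial>A)"
    by (rule convolution_emeasure) (auto intro: A.finite_measure E.finite_measure
        A.finite_measure_axioms E.finite_measure_axioms simp: A.M_is_borel E.M_is_borel)
  also have "\<dots> = (\<integral>\<^sup>+x. ennreal (tail E (u - x)) \<partial>A)"
  proof (rule nn_integral_cong)
    fix x
    have "{a. a + x \<in> {u<..}} = {u - x<..}"
      by auto
    then show "emeasure E {a. a + x \<in> {u<..}} = ennreal (tail E (u - x))"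
      by (simp add: tail_def E.emeasure_eq_measure)
  qed
  finally have "emeasure (A \<star> E) {u<..} = (\<integral>\<^sup>+x. ennreal (tail E (u - x)) \<partial>A)" .
  moreover have "(\<integral>x. tail E (u - x) \<partial>A) = enn2real (\<integral>\<^sup>+x. ennreal (tail E (u - x)) \<partial>A)"
    by (rule integral_eq_nn_integral) auto
  ultimately show ?thesis
    by (simp add: tail_def[of "A \<star> E"] measure_def)
qed

lemma half_line_distribution_convolution:
  assumes "half_line_distribution A" "half_line_distribution E"
  shows "half_line_distribution (A \<star> E)"
proof -
  interpret A: half_line_distribution A by fact
  interpret E: half_line_distribution E by fact
  have [measurable_cong]: "sets A = sets borel" "sets E = sets borel"
    using A.M_is_borel E.M_is_borel by auto
  interpret P: pair_prob_space A E ..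
  have "prob_space (A \<star> E)"
    unfolding convolution_def by (rule P.prob_space_distr) simp
  then interpret C: real_distribution "A \<star> E"
    by (simp add: real_distribution_def real_distribution_axioms_def)
  have "AE x in A. AE y in E. 0 \<le> x + y"
    using A.AE_nonneg
  proof eventually_elim
    fix x :: real assume "0 \<le> x"
    show "AE y in E. 0 \<le> x + y"
      using E.AE_nonneg by eventually_elim (use \<open>0 \<le> x\<close> in simp)
  qed
  have "emeasure (A \<star> E) {..<0} = (\<integral>\<^sup>+x. \<integral>\<^sup>+y. indicator {..<0} (x + y) \<partial>E \<partial>A)"
    by (rule convolution_emeasure') (auto simp: A.finite_measure_axioms E.finite_measure_axioms A.M_is_borel E.M_is_borel)
  also have "\<dots> = (\<integral>\<^sup>+x. 0 \<partial>A)"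
    using \<open>AE x in A. AE y in E. 0 \<le> x + y\<close>
  proof (intro nn_integral_cong_AE, eventually_elim)
    fix x assume "AE y in E. 0 \<le> x + y"
    then have "(\<integral>\<^sup>+y. indicator {..<0} (x + y) \<partial>E) = (\<integral>\<^sup>+y. 0 \<partial>E)"
      by (intro nn_integral_cong_AE) (auto split: split_indicator)
    then show "(\<integral>\<^sup>+y. indicator {..<0} (x + y) \<partial>E) = 0"
      by simp
  qed
  finally have "measure (A \<star> E) {..<0} = 0"
    by (simp add: measure_def)
  then show ?thesis
    by unfold_locales
qed

lemma (in half_line_distribution) integrable_bounded_real:
  assumes [measurable]: "f \<in> borel_measurable borel" and "\<And>x. \<bar>f x\<bar> \<le> (B::real)"
  shows "integrable M f"
  using assms by (intro integrable_const_bound[where B = B]) auto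

text \<open>In the integral over \<open>A\<close>, points x up to u - v fall under the comparison of
  \<open>E\<close> with \<open>D\<close>; the remaining ones have mass \<open>tail A (u - v)\<close>
  and an integrand of at most 1. Subtracting \<open>tail A u\<close> discards the points beyond u,
  where the tail of \<open>D\<close> at u - x is 1, so that \<open>c\<close> multiplies only the
  excess of the convolution over \<open>A\<close>.\<close>

lemma tail_convolution_upper:
  assumes "half_line_distribution A" "half_line_distribution D" "half_line_distribution E"
    and "0 \<le> v" "0 \<le> c" and le: "\<And>w. v \<le> w \<Longrightarrow> tail E w \<le> c * tail D w"
  shows "tail (A \<star> E) u \<le> tail A (u - v) + c * (tail (A \<star> D) u - tail A u)"
proof -
  interpret A: half_line_distribution A by fact
  interpret D: half_line_distribution D by fact
  interpret E: half_line_distribution E by fact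
  note int = A.integrable_bounded_real[where B = 1]
  have i[simp]: "integrable A (\<lambda>x. tail E (u - x))" "integrable A (\<lambda>x. tail D (u - x))"
    "integrable A (indicator {w<..} :: real \<Rightarrow> real)" for w
    by (auto intro!: int split: split_indicator)
  have "tail (A \<star> E) u = (\<integral>x. tail E (u - x) \<partial>A)"
    by (rule tail_convolution) fact+
  also have "\<dots> \<le> (\<integral>x. indicator {u - v<..} x + c * (tail D (u - x) - indicator {u<..} x) \<partial>A)"
  proof (rule integral_mono)
    fix x
    show "tail E (u - x) \<le> indicator {u - v<..} x + c * (tail D (u - x) - indicator {u<..} x)"
    proof (cases "x \<le> u - v")
      case True
      then show ?thesis
        using le[of "u - x"] \<open>0 \<le> v\<close> by simp
    next
      case False
      have "indicator {u<..} x \<le> tail D (u - x)"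
        using D.tail_negative[of "u - x"] by (auto split: split_indicator)
      with False \<open>0 \<le> c\<close> show ?thesis
        using E.tail_le_1[of "u - x"] by (simp add: add_increasing2)
    qed
  qed simp_all
  also have "\<dots> = tail A (u - v) + c * (tail (A \<star> D) u - tail A u)"
    using assms by (simp add: tail_convolution[OF assms(1,2)] tail_def[of A])
  finally show ?thesis .
qed

text \<open>The left side is the probability that the larger of two independent variables with laws
  \<open>A\<close> and \<open>E\<close> exceeds u, and for nonnegative variables the sum dominates
  the maximum.\<close>

lemma tail_convolution_lower:
  assumes "half_line_distribution A" "half_line_distribution E"
  shows "tail A u + tail E u * (1 - tail A u) \<le> tail (A \<star> E) u"
proof -
  interpret A: half_line_distribution A by fact
  interpret E: half_line_distribution E by fact
  note int = A.integrable_bounded_real[where B = 1]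
  have i[simp]: "integrable A (\<lambda>x. tail E (u - x))"
    "integrable A (indicator {w<..} :: real \<Rightarrow> real)" for w
    by (auto intro!: int split: split_indicator)
  have "tail A u + tail E u * (1 - tail A u)
      = (\<integral>x. indicator {u<..} x + tail E u * (1 - indicator {u<..} x) \<partial>A)"
    by (simp add: tail_def[of A] A.prob_space[simplified])
  also have "\<dots> \<le> (\<integral>x. tail E (u - x) \<partial>A)"
  proof (rule integral_mono_AE)
    show "AE x in A. indicator {u<..} x + tail E u * (1 - indicator {u<..} x) \<le> tail E (u - x)"
      using A.AE_nonneg
      by eventually_elim (auto simp: E.tail_negative E.tail_mono split: split_indicator)
  qed simp_all
  finally show ?thesis
    using tail_convolution[OF assms] by simp
qed

subsection \<open>Subexponential distributions\<close>

definition long_tailed :: "real measure \<Rightarrow> bool" where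
  "long_tailed D \<longleftrightarrow> (\<forall>v\<ge>0. ((\<lambda>u. tail D (u - v) / tail D u) \<longlongrightarrow> 1) at_top)"

lemma filterlim_minus_const_at_top: "filterlim (\<lambda>u. u - v) at_top (at_top :: real filter)"
  using filterlim_tendsto_add_at_top[OF tendsto_const[of "- v"] filterlim_ident] by simp

text \<open>In the limit \<open>l\<close>, the summand \<open>A\<close> accounts for 1 and
  \<open>D\<close> for l - 1; exchanging \<open>D\<close> for an \<open>E\<close> with c times its
  tail scales the second part by c. Long-tailedness absorbs the shift in
  \<open>tail_convolution_upper\<close>, and \<open>EA\<close> makes the lower bound meet the upper
  one. With varying roles of \<open>A\<close>, \<open>D\<close> and \<open>E\<close> this serves
  n-fold convolutions as well as closure under tail equivalence.\<close>

lemma tail_convolution_ratio: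
  assumes "half_line_distribution A" "half_line_distribution D" "half_line_distribution E"
    and posA: "\<And>u. tail A u > 0" and posD: "\<And>u. tail D u > 0"
    and A: "long_tailed A"
    and ED: "((\<lambda>u. tail E u / tail D u) \<longlongrightarrow> c) at_top"
    and AD: "((\<lambda>u. tail (A \<star> D) u / tail A u) \<longlongrightarrow> l) at_top"
    and EA: "((\<lambda>u. tail E u / tail A u) \<longlongrightarrow> c * (l - 1)) at_top"
  shows "((\<lambda>u. tail (A \<star> E) u / tail A u) \<longlongrightarrow> 1 + c * (l - 1)) at_top"
proof (rule order_tendstoI)
  interpret A: half_line_distribution A by fact
  interpret D: half_line_distribution D by fact
  interpret E: half_line_distribution E by fact
  have lower: "1 + tail E u / tail A u * (1 - tail A u) \<le> tail (A \<star> E) u / tail A u" for u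
    using divide_right_mono[OF tail_convolution_lower[OF assms(1,3), of u] A.tail_nonneg[of u]] posA[of u]
    by (simp add: add_divide_distrib less_imp_neq[symmetric])
  fix b assume b: "b < 1 + c * (l - 1)"
  have "((\<lambda>u. 1 + tail E u / tail A u * (1 - tail A u)) \<longlongrightarrow> 1 + c * (l - 1) * (1 - 0)) at_top"
    by (intro tendsto_intros EA A.tail_tendsto_0)
  then have "eventually (\<lambda>u. b < 1 + tail E u / tail A u * (1 - tail A u)) at_top"
    using b by (intro order_tendstoD) auto
  then show "eventually (\<lambda>u. b < tail (A \<star> E) u / tail A u) at_top"
    by eventually_elim (use lower in \<open>auto intro: less_le_trans\<close>)
next
  interpret A: half_line_distribution A by fact
  interpret D: half_line_distribution D by fact
  interpret E: half_line_distribution E by fact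
  have "0 \<le> c"
    using ED by (rule tendsto_lowerbound) (auto intro!: always_eventually divide_nonneg_pos posD)
  fix b assume b: "1 + c * (l - 1) < b"
  \<comment> \<open>A strictly positive bound for l - 1, so that the slack in b can be divided by it
    whatever the sign of l - 1.\<close>
  define L where "L = \<bar>l - 1\<bar> + 1"
  have L: "0 < L" "l - 1 \<le> L"
    by (auto simp: L_def)
  define \<delta> where "\<delta> = (b - (1 + c * (l - 1))) / (2 * L)"
  have "\<delta> > 0"
    unfolding \<delta>_def using b L by (intro divide_pos_pos) auto
  have "\<delta> * (l - 1) \<le> \<delta> * L"
    using \<open>\<delta> > 0\<close> L by (intro mult_left_mono) auto
  also have "\<dots> = (b - (1 + c * (l - 1))) / 2"
    using L by (simp add: \<delta>_def)
  finally have b': "1 + (c + \<delta>) * (l - 1) < b"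
    using b by (simp add: algebra_simps)
  have "eventually (\<lambda>u. tail E u / tail D u < c + \<delta>) at_top"
    using ED \<open>\<delta> > 0\<close> by (intro order_tendstoD) auto
  then obtain v0 where v0: "\<And>w. v0 \<le> w \<Longrightarrow> tail E w / tail D w < c + \<delta>"
    by (auto simp: eventually_at_top_linorder)
  \<comment> \<open>The comparison lemma and \<open>long_tailed\<close> only speak of nonnegative
    shifts.\<close>
  define v where "v = max v0 0"
  have le: "tail E w \<le> (c + \<delta>) * tail D w" if "v \<le> w" for w
    using v0[of w] that posD[of w] by (simp add: v_def field_simps)
  have upper: "tail (A \<star> E) u / tail A u
      \<le> tail A (u - v) / tail A u + (c + \<delta>) * (tail (A \<star> D) u / tail A u - 1)" for u
  proof -
    have "tail (A \<star> E) u \<le> tail A (u - v) + (c + \<delta>) * (tail (A \<star> D) u - tail A u)"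
      using \<open>0 \<le> c\<close> \<open>\<delta> > 0\<close> by (intro tail_convolution_upper le) (auto simp: v_def assms)
    then have "tail (A \<star> E) u / tail A u
        \<le> (tail A (u - v) + (c + \<delta>) * (tail (A \<star> D) u - tail A u)) / tail A u"
      using posA[of u] by (intro divide_right_mono) auto
    also have "\<dots> = tail A (u - v) / tail A u + (c + \<delta>) * (tail (A \<star> D) u / tail A u - 1)"
      using posA[of u] by (simp add: field_simps)
    finally show ?thesis .
  qed
  have "((\<lambda>u. tail A (u - v) / tail A u + (c + \<delta>) * (tail (A \<star> D) u / tail A u - 1))
      \<longlongrightarrow> 1 + (c + \<delta>) * (l - 1)) at_top"
    using A by (intro tendsto_intros AD) (auto simp: long_tailed_def v_def)
  then have "eventually (\<lambda>u. tail A (u - v) / tail A u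
      + (c + \<delta>) * (tail (A \<star> D) u / tail A u - 1) < b) at_top"
    using b' by (intro order_tendstoD) auto
  then show "eventually (\<lambda>u. tail (A \<star> E) u / tail A u < b) at_top"
    by eventually_elim (use upper in \<open>auto intro: le_less_trans\<close>)
qed

text \<open>The twofold limit is the form in which the property passes to tail equivalent laws;
  \<open>conv_iter_tail_ratio\<close> recovers the n-fold limits from it by induction.\<close>

locale subexponential_distribution = half_line_distribution +
  assumes tail_pos: "\<And>u. tail M u > 0"
    and twofold: "((\<lambda>u. tail (M \<star> M) u / tail M u) \<longlongrightarrow> 2) at_top"
begin

lemma tail_pos' [simp]: "tail M u \<noteq> 0" "tail M u > 0"
  using tail_pos[of u] by auto

text \<open>Split the integral for the twofold tail at y and u: the integrand is at least
  \<open>tail M u\<close> on [0, y], at least \<open>tail M (u - y)\<close> on (y, u], and 1 beyond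
  u. Solving for the ratio of \<open>tail M (u - y)\<close> to \<open>tail M u\<close> gives an
  upper bound which tends to 1 precisely because the twofold limit is 2; monotonicity gives the
  lower bound 1.\<close>

lemma long_tailed: "long_tailed M"
  unfolding long_tailed_def
proof (intro allI impI)
  fix y :: real assume "0 \<le> y"
  note int = integrable_bounded_real[where B = 1]
  have i[simp]: "integrable M (\<lambda>x. tail M (u - x))"
    "integrable M (indicator {w<..} :: real \<Rightarrow> real)" for w u
    by (auto intro!: int split: split_indicator)
  have ineq: "tail M u + tail M u * (1 - tail M y) + tail M (u - y) * (tail M y - tail M u)
      \<le> tail (M \<star> M) u" if "y \<le> u" for u
  proof -
    have "(\<integral>x. indicator {u<..} x + tail M u * (1 - indicator {y<..} x)
          + tail M (u - y) * (indicator {y<..} x - indicator {u<..} x) \<partial>M)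
        \<le> (\<integral>x. tail M (u - x) \<partial>M)"
    proof (rule integral_mono_AE)
      show "AE x in M. indicator {u<..} x + tail M u * (1 - indicator {y<..} x)
          + tail M (u - y) * (indicator {y<..} x - indicator {u<..} x) \<le> tail M (u - x)"
        using AE_nonneg
        by eventually_elim (use \<open>y \<le> u\<close> in \<open>auto simp: tail_negative tail_mono split: split_indicator\<close>)
    qed simp_all
    then show ?thesis
      using tail_convolution[OF half_line_distribution_axioms half_line_distribution_axioms, of u] prob_space by (simp add: tail_def[of M])
  qed
  have "eventually (\<lambda>u. tail M u < tail M y) at_top"
    using tail_tendsto_0 tail_pos[of y] by (intro order_tendstoD)
  then have upper: "eventually (\<lambda>u. tail M (u - y) / tail M u
      \<le> (tail (M \<star> M) u / tail M u - 1 - (1 - tail M y)) / (tail M y - tail M u)) at_top"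
    using eventually_ge_at_top[of y]
  proof eventually_elim
    fix u assume u: "tail M u < tail M y" "y \<le> u"
    have "tail M (u - y) / tail M u * (tail M y - tail M u)
       = tail M (u - y) * (tail M y - tail M u) / tail M u"
      by simp
    also have "\<dots> \<le> (tail (M \<star> M) u - tail M u - tail M u * (1 - tail M y)) / tail M u"
      using ineq[OF u(2)] tail_pos[of u] by (intro divide_right_mono) auto
    also have "\<dots> = tail (M \<star> M) u / tail M u - 1 - (1 - tail M y)"
      using tail_pos'(1)[of u] by (simp add: diff_divide_distrib)
    finally show "tail M (u - y) / tail M u
        \<le> (tail (M \<star> M) u / tail M u - 1 - (1 - tail M y)) / (tail M y - tail M u)"
      using u by (simp add: pos_le_divide_eq)
  qed
  have "((\<lambda>u. (tail (M \<star> M) u / tail M u - 1 - (1 - tail M y)) / (tail M y - tail M u))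
      \<longlongrightarrow> (2 - 1 - (1 - tail M y)) / (tail M y - 0)) at_top"
    by (intro tendsto_intros twofold tail_tendsto_0) auto
  then have lim: "((\<lambda>u. (tail (M \<star> M) u / tail M u - 1 - (1 - tail M y)) / (tail M y - tail M u))
      \<longlongrightarrow> 1) at_top"
    by simp
  have "eventually (\<lambda>u. 1 \<le> tail M (u - y) / tail M u) at_top"
    using \<open>0 \<le> y\<close> tail_mono by (intro always_eventually) auto
  then show "((\<lambda>u. tail M (u - y) / tail M u) \<longlongrightarrow> 1) at_top"
    using upper tendsto_const lim by (rule tendsto_sandwich)
qed

end

text \<open>\<open>conv_iter D n\<close> is the law of a sum of \<open>n + 1\<close> independent variables with law \<open>D\<close>.\<close>

primrec conv_iter :: "real measure \<Rightarrow> nat \<Rightarrow> real measure" where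
  "conv_iter D 0 = D"
| "conv_iter D (Suc n) = (D \<star> conv_iter D n)"

lemma (in half_line_distribution) half_line_distribution_conv_iter:
  "half_line_distribution (conv_iter M n)"
  by (induction n) (auto intro: half_line_distribution_convolution half_line_distribution_axioms)

context subexponential_distribution
begin

text \<open>Each further summand adds one copy of the tail: \<open>tail_convolution_ratio\<close>
  with c = n + 1 and l = 2.\<close>

lemma conv_iter_tail_ratio:
  "((\<lambda>u. tail (conv_iter M n) u / tail M u) \<longlongrightarrow> real (Suc n)) at_top"
proof (induction n)
  case 0
  then show ?case by simp
next
  case (Suc n)
  have "((\<lambda>u. tail (M \<star> conv_iter M n) u / tail M u) \<longlongrightarrow> 1 + real (Suc n) * (2 - 1)) at_top"
    using Suc.IH twofold long_tailed tail_pos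
    by (intro tail_convolution_ratio[where D = M] half_line_distribution_axioms half_line_distribution_conv_iter) auto
  then show ?case
    by (simp add: algebra_simps)
qed

text \<open>Beyond some v, convolving once more multiplies the bound by at most 1 + \<delta> and
  adds one tail; below v the trivial bound 1 is at most a fixed multiple of the tail. Both cases
  obey the recursion \<alpha>' = b + (1 + \<delta>) \<alpha>, whose solution starting from 1 is
  \<open>K * (1 + \<delta>) ^ n - b / \<delta>\<close>.\<close>

lemma kesten_bound:
  assumes "\<delta> > 0"
  obtains K where "\<And>n u. tail (conv_iter M n) u \<le> K * (1 + \<delta>) ^ n * tail M u"
proof -
  have "eventually (\<lambda>u. tail (M \<star> M) u / tail M u < 2 + \<delta>) at_top"
    using twofold assms by (intro order_tendstoD) auto
  then obtain v where v: "\<And>u. v \<le> u \<Longrightarrow> tail (M \<star> M) u / tail M u < 2 + \<delta>"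
    by (auto simp: eventually_at_top_linorder)
  have v': "tail (M \<star> M) u - tail M u \<le> (1 + \<delta>) * tail M u" if "v \<le> u" for u
    using v[OF that] tail_pos[of u] by (simp add: field_simps)
  \<comment> \<open>The summand 1 pays for the added tail when u is at least v, and
    \<open>1 / tail M v\<close> pays for the trivial bound when u is below v.\<close>
  define b where "b = 1 + 1 / tail M v"
  have "b > 0"
    using tail_pos[of v] by (simp add: b_def add_pos_pos)
  \<comment> \<open>Chosen so that the coefficient equals 1 for n = 0; - b / \<delta> is the fixed
    point of the recursion.\<close>
  define K where "K = 1 + b / \<delta>"
  have "K \<ge> 1"
    using \<open>b > 0\<close> \<open>\<delta> > 0\<close> by (simp add: K_def)
  have coeff: "1 \<le> K * (1 + \<delta>) ^ n - b / \<delta>" for n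
  proof -
    have "K * 1 \<le> K * (1 + \<delta>) ^ n"
      using \<open>K \<ge> 1\<close> \<open>\<delta> > 0\<close> by (intro mult_left_mono) auto
    then show ?thesis
      by (simp add: K_def)
  qed
  have "tail (conv_iter M n) u \<le> (K * (1 + \<delta>) ^ n - b / \<delta>) * tail M u" for n u
  proof (induction n arbitrary: u)
    case 0
    then show ?case by (simp add: K_def)
  next
    case (Suc n)
    define \<alpha> where "\<alpha> = K * (1 + \<delta>) ^ n - b / \<delta>"
    have "\<alpha> \<ge> 0"
      using coeff[of n] by (simp add: \<alpha>_def)
    have \<alpha>': "K * (1 + \<delta>) ^ Suc n - b / \<delta> = b + \<alpha> * (1 + \<delta>)"
      using \<open>\<delta> > 0\<close> by (simp add: \<alpha>_def field_simps)
    show ?case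
    proof (cases "v \<le> u")
      case True
      \<comment> \<open>The induction hypothesis holds at every argument, so the comparison needs no
        shift and v = 0 is admissible there.\<close>
      have "tail (conv_iter M (Suc n)) u \<le> tail M (u - 0) + \<alpha> * (tail (M \<star> M) u - tail M u)"
        using Suc.IH \<open>\<alpha> \<ge> 0\<close> unfolding conv_iter.simps
        by (intro tail_convolution_upper half_line_distribution_axioms half_line_distribution_conv_iter)
           (auto simp: \<alpha>_def)
      also have "\<dots> \<le> tail M u + \<alpha> * ((1 + \<delta>) * tail M u)"
        using v'[OF True] \<open>\<alpha> \<ge> 0\<close> by (auto intro: mult_left_mono)
      also have "\<dots> = (1 + \<alpha> * (1 + \<delta>)) * tail M u"
        by (simp add: algebra_simps)
      also have "\<dots> \<le> (b + \<alpha> * (1 + \<delta>)) * tail M u"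
        by (intro mult_right_mono) (auto simp: b_def)
      finally show ?thesis
        unfolding \<alpha>' .
    next
      case False
      interpret I: half_line_distribution "conv_iter M (Suc n)"
        by (rule half_line_distribution_conv_iter)
      have "tail (conv_iter M (Suc n)) u \<le> 1"
        by (rule I.tail_le_1)
      also have "1 \<le> 1 / tail M v * tail M u"
        using False tail_mono[of u v] tail_pos[of v] by (simp add: field_simps)
      also have "\<dots> \<le> (b + \<alpha> * (1 + \<delta>)) * tail M u"
        using \<open>\<alpha> \<ge> 0\<close> \<open>\<delta> > 0\<close> by (intro mult_right_mono) (auto simp: b_def)
      finally show ?thesis
        unfolding \<alpha>' .
    qed
  qed
  then have "tail (conv_iter M n) u \<le> K * (1 + \<delta>) ^ n * tail M u" for n u
    by (rule order_trans) (use \<open>b > 0\<close> \<open>\<delta> > 0\<close> in \<open>auto intro!: mult_right_mono\<close>)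
  then show ?thesis
    by (rule that)
qed

text \<open>One factor is replaced at a time. The law M * E has tail (1 + c) times that of
  \<open>M\<close>; read as E * M and relative to \<open>E\<close>, this is l = (1 + c) / c.
  Replacing the remaining \<open>M\<close> by \<open>E\<close> then yields 1 + c (l - 1) =
  2.\<close>

lemma tail_equivalent_subexponential:
  assumes "half_line_distribution E" "\<And>u. tail E u > 0" "c > 0"
    and ED: "((\<lambda>u. tail E u / tail M u) \<longlongrightarrow> c) at_top"
  shows "subexponential_distribution E"
proof -
  interpret E: half_line_distribution E by fact
  have DE: "((\<lambda>u. tail M u / tail E u) \<longlongrightarrow> 1 / c) at_top"
    using tendsto_inverse[OF ED] \<open>c > 0\<close> by (simp add: inverse_eq_divide)
  have "((\<lambda>u. tail (M \<star> E) u / tail M u) \<longlongrightarrow> 1 + c * (2 - 1)) at_top"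
    using ED twofold long_tailed tail_pos
    by (intro tail_convolution_ratio[where D = M] half_line_distribution_axioms assms) auto
  also have "(M \<star> E) = (E \<star> M)"
    using finite_measure_axioms E.finite_measure_axioms
    by (intro convolution_commutative) (auto simp: M_is_borel E.M_is_borel)
  finally have "((\<lambda>u. tail (E \<star> M) u / tail M u * (tail M u / tail E u))
      \<longlongrightarrow> (1 + c * (2 - 1)) * (1 / c)) at_top"
    by (intro tendsto_mult DE)
  then have EM: "((\<lambda>u. tail (E \<star> M) u / tail E u) \<longlongrightarrow> (1 + c) / c) at_top"
    by simp
  have "long_tailed E"
    unfolding long_tailed_def
  proof (intro allI impI)
    fix v :: real assume "0 \<le> v"
    have "((\<lambda>u. tail E (u - v) / tail M (u - v) * (tail M (u - v) / tail M u) * (tail M u / tail E u))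
        \<longlongrightarrow> c * 1 * (1 / c)) at_top"
      using long_tailed \<open>0 \<le> v\<close>
      by (intro tendsto_mult DE filterlim_compose[OF ED filterlim_minus_const_at_top])
        (auto simp: long_tailed_def)
    then show "((\<lambda>u. tail E (u - v) / tail E u) \<longlongrightarrow> 1) at_top"
      using \<open>c > 0\<close> by simp
  qed
  have "((\<lambda>u. tail (E \<star> E) u / tail E u) \<longlongrightarrow> 1 + c * ((1 + c) / c - 1)) at_top"
  proof (rule tail_convolution_ratio[where D = M])
    have "eventually (\<lambda>u. tail E u / tail E u = 1) at_top"
      using assms(2) by (intro always_eventually) (simp add: less_imp_neq[symmetric])
    then show "((\<lambda>u. tail E u / tail E u) \<longlongrightarrow> c * ((1 + c) / c - 1)) at_top"
      using \<open>c > 0\<close> by (auto simp: field_simps intro: tendsto_eventually)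
  qed (fact | rule half_line_distribution_axioms tail_pos)+
  then have "((\<lambda>u. tail (E \<star> E) u / tail E u) \<longlongrightarrow> 2) at_top"
    using \<open>c > 0\<close> by (simp add: field_simps)
  then show ?thesis
    using assms(2) by unfold_locales
qed

text \<open>By long-tailedness a unit step eventually shrinks the tail by a factor no smaller than
  exp (- c / 2). Hence the tail decays no faster than a multiple of exp (- c u / 2), and half of the
  exponential rate is left over.\<close>

lemma exponential_tail_negligible:
  assumes "c > 0"
  shows "((\<lambda>u. exp (- c * u) / tail M u) \<longlongrightarrow> 0) at_top"
proof -
  define r where "r = exp (c / 2)"
  have "r > 1" using assms by (simp add: r_def)
  have "((\<lambda>u. tail M (u - 1) / tail M u) \<longlongrightarrow> 1) at_top"
    using long_tailed by (simp add: long_tailed_def)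
  then have "eventually (\<lambda>u. tail M (u - 1) / tail M u < r) at_top"
    using \<open>r > 1\<close> by (rule order_tendstoD)
  then obtain v where v: "\<And>u. v \<le> u \<Longrightarrow> tail M (u - 1) < r * tail M u"
    by (auto simp: eventually_at_top_linorder field_simps)
  have *: "tail M v \<le> r ^ k * tail M (v + real k)" for k
  proof (induction k)
    case (Suc k)
    have "tail M (v + real k) \<le> r * tail M (v + real (Suc k))"
      using v[of "v + real (Suc k)"] by (simp add: algebra_simps)
    then have "r ^ k * tail M (v + real k) \<le> r ^ k * (r * tail M (v + real (Suc k)))"
      using \<open>r > 1\<close> by (intro mult_left_mono) auto
    with Suc show ?case by (simp add: algebra_simps)
  qed simp
  have bound: "exp (- c * u) / tail M u \<le> (exp (c / 2 - c / 2 * v) / tail M v) * exp (- (c / 2) * u)"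
    if "v \<le> u" for u
  proof -
    define k where "k = nat \<lceil>u - v\<rceil>"
    have k: "u \<le> v + real k" "real k \<le> u - v + 1"
      using that by (auto simp: k_def) linarith+
    have "tail M v \<le> r ^ k * tail M u"
      using *[of k] tail_mono[OF k(1)] \<open>r > 1\<close> by (meson mult_left_mono order_trans zero_le_power less_imp_le zero_less_one)
    also have "r ^ k = exp (real k * (c / 2))"
      by (simp add: r_def exp_of_nat_mult[symmetric])
    also have "\<dots> \<le> exp ((u - v + 1) * (c / 2))"
      using k(2) assms by (simp add: mult_right_mono)
    finally have "tail M v \<le> exp ((u - v + 1) * (c / 2)) * tail M u"
      by (simp add: mult_right_mono)
    then have "exp (- c * u) * tail M v \<le> exp (- c * u) * (exp ((u - v + 1) * (c / 2)) * tail M u)"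
      by (intro mult_left_mono) auto
    also have "\<dots> = exp (c / 2 - c / 2 * v) * exp (- (c / 2) * u) * tail M u"
    proof -
      have "- c * u + (u - v + 1) * (c / 2) = (c / 2 - c / 2 * v) + (- (c / 2) * u)"
        by (simp add: field_simps)
      then show ?thesis
        by (simp only: mult.assoc[symmetric] exp_add[symmetric])
    qed
    finally show ?thesis
      using tail_pos[of u] tail_pos[of v] by (simp add: field_simps)
  qed
  have "((\<lambda>u. exp (- (c / 2) * u)) \<longlongrightarrow> 0) at_top"
    using assms by (intro filterlim_compose[OF exp_at_bot]
        filterlim_tendsto_neg_mult_at_bot[OF tendsto_const _ filterlim_ident]) auto
  then have "((\<lambda>u. (exp (c / 2 - c / 2 * v) / tail M v) * exp (- (c / 2) * u)) \<longlongrightarrow> 0) at_top"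
    by (rule tendsto_mult_right_zero)
  then show ?thesis
    using bound by (rule_tac tendsto_sandwich[OF _ _ tendsto_const])
      (auto intro!: always_eventually divide_nonneg_pos simp: eventually_at_top_linorder)
qed

end

section \<open>From distribution functions to laws on the half-line\<close>

lemma convolution_return_0:
  assumes "real_distribution D"
  shows "(D \<star> return borel 0) = D"
proof -
  interpret D: real_distribution D by fact
  interpret O: prob_space "return borel (0::real)"
    by (rule prob_space_return) simp
  show ?thesis
  proof (rule measure_eqI)
    fix X assume "X \<in> sets (D \<star> return borel 0)"
    then have X[measurable]: "X \<in> sets borel" by simp
    have "emeasure (D \<star> return borel 0) X = (\<integral>\<^sup>+x. \<integral>\<^sup>+y. indicator X (x + y) \<partial>return borel 0 \<partial>D)"
      using D.finite_measure_axioms O.finite_measure_axioms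
      by (intro convolution_emeasure') (auto simp: D.M_is_borel)
    also have "\<dots> = (\<integral>\<^sup>+x. indicator X x \<partial>D)"
      by (intro nn_integral_cong) (subst nn_integral_return, auto)
    also have "\<dots> = emeasure D X"
      by (auto simp: D.M_is_borel)
    finally show "emeasure (D \<star> return borel 0) X = emeasure D X" .
  qed (simp add: D.M_is_borel)
qed

text \<open>The mass of the open negative half-line is the left limit of the distribution function
  at 0.\<close>

lemma half_line_distributionI:
  assumes "real_distribution D" "\<And>x. x < 0 \<Longrightarrow> cdf D x = 0"
  shows "half_line_distribution D"
proof -
  interpret D: real_distribution D by fact
  have "eventually (\<lambda>x. cdf D x = 0) (at_left 0)"
    using assms(2) by (auto simp: eventually_at_left_field intro: exI[of _ "-1"])
  then have "(cdf D \<longlongrightarrow> 0) (at_left 0)"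
    by (rule tendsto_eventually)
  then have "measure D {..<0} = 0"
    using D.cdf_at_left[of 0] by (intro tendsto_unique[of "at_left (0::real)"]) auto
  then show ?thesis
    by unfold_locales
qed

lemma df_nonneg_half_line_distribution:
  assumes "df_nonneg F"
  shows "half_line_distribution (interval_measure F)" "cdf (interval_measure F) = F"
proof -
  have F: "\<And>x y. x \<le> y \<Longrightarrow> F x \<le> F y" "\<And>a. continuous (at_right a) F" "(F \<longlongrightarrow> 1) at_top"
    "\<And>x. x < 0 \<Longrightarrow> F x = 0"
    using assms by (auto simp: df_nonneg_def mono_def)
  have bot: "(F \<longlongrightarrow> 0) at_bot"
    using F(4) by (intro tendsto_eventually) (auto simp: eventually_at_bot_dense)
  show cdf: "cdf (interval_measure F) = F"
    using F bot by (intro cdf_interval_measure)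
  interpret D: real_distribution "interval_measure F"
    using F bot by (intro real_distribution_interval_measure)
  show "half_line_distribution (interval_measure F)"
    using F(4) by (intro half_line_distributionI D.real_distribution_axioms) (simp add: cdf)
qed

lemma subexponential_imp_subexponential_distribution:
  assumes "subexponential F"
  shows "subexponential_distribution (interval_measure F)"
    and "tail (interval_measure F) u = 1 - F u"
proof -
  have df: "df_nonneg F" and pos: "\<And>u. 1 - F u > 0"
    and conv: "(\<lambda>u. 1 - conv_power 2 F u) \<sim>[at_top] (\<lambda>u. real 2 * (1 - F u))"
    using assms unfolding subexponential_def by - (blast, blast, metis one_le_numeral)
  interpret D: half_line_distribution "interval_measure F"
    using df by (rule df_nonneg_half_line_distribution)
  have tail: "tail (interval_measure F) u = 1 - F u" for u
    using df_nonneg_half_line_distribution[OF df] D.tail_eq_cdf by simp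
  then show "tail (interval_measure F) u = 1 - F u" .
  interpret DD: half_line_distribution "interval_measure F \<star> interval_measure F"
    by (intro half_line_distribution_convolution D.half_line_distribution_axioms)
  have "conv_power 2 F = cdf (interval_measure F \<star> interval_measure F)"
    by (simp add: conv_power_def numeral_2_eq_2 convolution_return_0 D.real_distribution_axioms)
  then have eq: "(\<lambda>u. tail (interval_measure F \<star> interval_measure F) u) \<sim>[at_top]
      (\<lambda>u. 2 * tail (interval_measure F) u)"
    using conv by (simp add: DD.tail_eq_cdf tail)
  have nz: "tail (interval_measure F) u \<noteq> 0" for u
    using pos[of u] tail[of u] by linarith
  have "((\<lambda>u. tail (interval_measure F \<star> interval_measure F) u
      / (2 * tail (interval_measure F) u)) \<longlongrightarrow> 1) at_top"
    by (rule asymp_equivD_strong[OF eq]) (simp add: nz)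
  then have "((\<lambda>u. 2 * (tail (interval_measure F \<star> interval_measure F) u
      / (2 * tail (interval_measure F) u))) \<longlongrightarrow> 2 * 1) at_top"
    by (intro tendsto_mult tendsto_const)
  then have "((\<lambda>u. tail (interval_measure F \<star> interval_measure F) u
      / tail (interval_measure F) u) \<longlongrightarrow> 2) at_top"
    by simp
  moreover have "0 < tail (interval_measure F) u" for u
    using pos[of u] tail[of u] by linarith
  ultimately show "subexponential_distribution (interval_measure F)"
    by unfold_locales
qed

subsection \<open>Phase-type distributions have exponential tails\<close>

context markov_jump_process
begin

definition transition :: "'s \<Rightarrow> real \<Rightarrow> 's \<Rightarrow> real" where
  "transition i t j = measure (P i) {\<omega> \<in> space (P i). J t \<omega> = j}"

lemma transition_nonneg [simp]: "0 \<le> transition i t j"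
  by (simp add: transition_def)

lemma state_event [measurable]:
  "i \<in> S \<Longrightarrow> 0 \<le> t \<Longrightarrow> j \<in> S \<Longrightarrow> {\<omega> \<in> space (P i). J t \<omega> = j} \<in> sets (P i)"
  using measurable_sets[OF measurable_J, of i t "{j}"] by (simp add: vimage_def Int_def conj_commute)

lemma state_in_S: "i \<in> S \<Longrightarrow> 0 \<le> t \<Longrightarrow> \<omega> \<in> space (P i) \<Longrightarrow> J t \<omega> \<in> S"
  using measurable_space[OF measurable_J, of i t \<omega>] by simp

lemma transition_le_1: "i \<in> S \<Longrightarrow> transition i t j \<le> 1"
  unfolding transition_def using prob_space_P by (intro prob_space.prob_le_1)

lemma sum_transition: "i \<in> S \<Longrightarrow> 0 \<le> t \<Longrightarrow> (\<Sum>j\<in>S. transition i t j) = 1"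
proof -
  assume i: "i \<in> S" "0 \<le> t"
  interpret prob_space "P i" using prob_space_P i by simp
  have "(\<Sum>j\<in>S. transition i t j) = prob (\<Union>j\<in>S. {\<omega> \<in> space (P i). J t \<omega> = j})"
    unfolding transition_def using i finite_states
    by (intro finite_measure_finite_Union[symmetric]) (auto simp: disjoint_family_on_def)
  also have "(\<Union>j\<in>S. {\<omega> \<in> space (P i). J t \<omega> = j}) = space (P i)"
    using state_in_S[OF i] by auto
  finally show ?thesis
    by (simp add: prob_space)
qed

lemma chapman_kolmogorov:
  assumes "i \<in> S" "j \<in> S" "0 \<le> s" "0 \<le> h"
  shows "transition i (s + h) j = (\<Sum>k\<in>S. transition i s k * transition k h j)"
proof -
  interpret prob_space "P i" using prob_space_P assms by simp
  have event: "{\<omega> \<in> space (P i). J s \<omega> = k \<and> J (s + h) \<omega> = j} \<in> sets (P i)" if "k \<in> S" for k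
  proof -
    have "{\<omega> \<in> space (P i). J s \<omega> = k \<and> J (s + h) \<omega> = j}
        = {\<omega> \<in> space (P i). J s \<omega> = k} \<inter> {\<omega> \<in> space (P i). J (s + h) \<omega> = j}"
      by auto
    also have "\<dots> \<in> sets (P i)"
      using assms that by (intro sets.Int state_event) auto
    finally show ?thesis .
  qed
  have "transition i s k * transition k h j
      = prob {\<omega> \<in> space (P i). J s \<omega> = k \<and> J (s + h) \<omega> = j}" if "k \<in> S" for k
    using markov[of i "\<lambda>_. s" 0 "\<lambda>_. k" h j] assms that
    by (auto simp: transition_def mono_on_def)
  then have "(\<Sum>k\<in>S. transition i s k * transition k h j)
      = (\<Sum>k\<in>S. prob {\<omega> \<in> space (P i). J s \<omega> = k \<and> J (s + h) \<omega> = j})"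
    by (intro sum.cong) auto
  also have "\<dots> = prob (\<Union>k\<in>S. {\<omega> \<in> space (P i). J s \<omega> = k \<and> J (s + h) \<omega> = j})"
    using finite_states event
    by (intro finite_measure_finite_Union[symmetric]) (auto simp: disjoint_family_on_def)
  also have "(\<Union>k\<in>S. {\<omega> \<in> space (P i). J s \<omega> = k \<and> J (s + h) \<omega> = j})
      = {\<omega> \<in> space (P i). J (s + h) \<omega> = j}"
    using state_in_S[of i s] assms by auto
  finally show ?thesis
    by (simp add: transition_def)
qed

lemma transition_prod_le:
  assumes "i \<in> S" "j \<in> S" "k \<in> S" "0 \<le> s" "0 \<le> h"
  shows "transition i s k * transition k h j \<le> transition i (s + h) j"
  unfolding chapman_kolmogorov[OF assms(1,2,4,5)]
  using assms finite_states by (intro member_le_sum) auto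

text \<open>Almost every path visits \<open>i\<close> only within a bounded time set, so the
  indicators of these visits are eventually 0 along the integers; dominated convergence turns this
  into a statement about probabilities.\<close>

lemma transient_transition_tendsto_0:
  assumes "i \<in> S" "transient i"
  shows "(\<lambda>n. transition i (real n) i) \<longlonglongrightarrow> 0"
proof -
  interpret prob_space "P i" using prob_space_P assms by simp
  define f where "f n = (indicator {\<omega> \<in> space (P i). J (real n) \<omega> = i} :: 'w \<Rightarrow> real)" for n
  have [measurable]: "f n \<in> borel_measurable (P i)" for n
    using assms(1) unfolding f_def by (intro borel_measurable_indicator state_event) auto
  have "(\<lambda>n. expectation (f n)) \<longlonglongrightarrow> expectation (\<lambda>_. 0)"
  proof (rule integral_dominated_convergence[where w = "\<lambda>_. 1"])
    show "AE \<omega> in P i. (\<lambda>n. f n \<omega>) \<longlonglongrightarrow> 0"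
      using assms(2) unfolding transient_def
    proof eventually_elim
      fix \<omega> assume "bounded {t. 0 \<le> t \<and> J t \<omega> = i}"
      then obtain b where b: "\<And>t. 0 \<le> t \<Longrightarrow> J t \<omega> = i \<Longrightarrow> \<bar>t\<bar> \<le> b"
        by (auto simp: bounded_iff)
      have "eventually (\<lambda>n. f n \<omega> = 0) sequentially"
        using eventually_gt_at_top[of "nat \<lceil>b\<rceil>"]
      proof eventually_elim
        fix n assume "nat \<lceil>b\<rceil> < n"
        then have "b < real n" by linarith
        then show "f n \<omega> = 0"
          using b[of "real n"] by (auto simp: f_def split: split_indicator)
      qed
      then show "(\<lambda>n. f n \<omega>) \<longlonglongrightarrow> 0"
        by (rule tendsto_eventually)
    qed
  qed (auto split: split_indicator simp: f_def[symmetric], simp add: f_def)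
  then show ?thesis
    using assms by (simp add: f_def transition_def)
qed

end

section \<open>Uniform geometric absorption on a finite state space\<close>

context absorbing_jump_process
begin

lemma transition_absorbing: "0 \<le> t \<Longrightarrow> transition \<Delta> t \<Delta> = 1"
proof -
  assume t: "0 \<le> t"
  interpret prob_space "P \<Delta>" using prob_space_P absorbing_state by simp
  have "AE \<omega> in P \<Delta>. \<forall>t\<ge>0. J t \<omega> = \<Delta>"
    using absorbing_state by (simp add: absorbing_def)
  then have "AE \<omega> in P \<Delta>. \<omega> \<in> {\<omega> \<in> space (P \<Delta>). J t \<omega> = \<Delta>}"
    by (rule AE_mp) (use t in auto)
  then show ?thesis
    unfolding transition_def using t absorbing_state by (subst prob_eq_1) auto
qed

lemma transition_absorbing_mono:
  assumes "i \<in> S" "0 \<le> s" "s \<le> t"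
  shows "transition i s \<Delta> \<le> transition i t \<Delta>"
  using transition_prod_le[of i \<Delta> \<Delta> s "t - s"] assms absorbing_state
  by (simp add: transition_absorbing)

text \<open>Integer times match the limit in \<open>transient_transition_tendsto_0\<close>; since
  absorption probabilities grow with time, they also suffice for finding a common time
  later.\<close>

definition reachable :: "'s \<Rightarrow> 's set" where
  "reachable i = {k \<in> S. \<exists>m. transition i (real m) k > 0}"

lemma reachable_refl: "i \<in> S \<Longrightarrow> i \<in> reachable i"
proof -
  assume i: "i \<in> S"
  interpret prob_space "P i" using prob_space_P i by simp
  have "transition i (real 0) i = 1"
    unfolding transition_def using i start[OF i] by (subst prob_eq_1) auto
  then show ?thesis
    using i unfolding reachable_def by (auto intro!: exI[of _ 0])
qed

lemma reachable_trans: "i \<in> S \<Longrightarrow> k \<in> reachable i \<Longrightarrow> reachable k \<subseteq> reachable i"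
proof
  fix j assume "i \<in> S" "k \<in> reachable i" "j \<in> reachable k"
  then obtain m n where *: "k \<in> S" "j \<in> S" "transition i (real m) k > 0" "transition k (real n) j > 0"
    by (auto simp: reachable_def)
  then have "0 < transition i (real m) k * transition k (real n) j"
    by simp
  also have "\<dots> \<le> transition i (real (m + n)) j"
    using transition_prod_le[of i j k "real m" "real n"] * \<open>i \<in> S\<close> by simp
  finally show "j \<in> reachable i"
    using *(2) unfolding reachable_def by blast
qed

text \<open>Otherwise some transient state \<open>i\<close> would communicate with every state reachable from it; then
  all the transition probabilities out of \<open>i\<close> would tend to \<open>0\<close>, although they add up to \<open>1\<close>.\<close>

lemma absorbing_reachable:
  assumes "j \<in> S"
  shows "\<Delta> \<in> reachable j"
proof (rule ccontr)
  assume no: "\<Delta> \<notin> reachable j"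
  \<comment> \<open>A state with the fewest reachable states lies in a closed class: anything
    reachable from it has the same reachable set and therefore leads back to it.\<close>
  define i where "i = arg_min_on (\<lambda>k. card (reachable k)) (reachable j)"
  have fin: "finite (reachable k)" for k
    using finite_states by (simp add: reachable_def)
  have ne: "reachable j \<noteq> {}"
    using reachable_refl assms by auto
  have i: "i \<in> reachable j" "i \<in> S"
    using arg_min_if_finite(1)[OF fin ne] by (auto simp: i_def reachable_def)
  have min: "card (reachable i) \<le> card (reachable k)" if "k \<in> reachable j" for k
    using arg_min_least[OF fin ne that] unfolding i_def .
  have "(\<lambda>n. transition i (real n) k) \<longlonglongrightarrow> 0" if "k \<in> S" for k
  proof (cases "k \<in> reachable i")
    case True
    then have "reachable k \<subseteq> reachable i" "k \<in> reachable j"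
      using i reachable_trans assms by auto
    then have "reachable k = reachable i"
      using min fin by (intro card_seteq)
    then obtain m where m: "transition k (real m) i > 0"
      using reachable_refl[OF i(2)] by (auto simp: reachable_def)
    have le: "transition i (real n) k \<le> transition i (real (n + m)) i / transition k (real m) i" for n
      using transition_prod_le[of i i k "real n" "real m"] i that m by (simp add: pos_le_divide_eq)
    have "i \<in> S - {\<Delta>}"
      using i no by auto
    then have "(\<lambda>n. transition i (real n) i) \<longlonglongrightarrow> 0"
      by (intro transient_transition_tendsto_0 transient_states) auto
    then have "(\<lambda>n. transition i (real (n + m)) i) \<longlonglongrightarrow> 0"
      by (rule LIMSEQ_ignore_initial_segment)
    then have "(\<lambda>n. transition i (real (n + m)) i / transition k (real m) i) \<longlonglongrightarrow> 0"
      by (rule tendsto_divide_zero)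
    then show ?thesis
      by (rule tendsto_sandwich[OF _ _ tendsto_const, rotated 2])
        (rule always_eventually, simp, rule always_eventually, use le in blast)
  next
    case False
    then have "transition i (real n) k = 0" for n
      using that transition_nonneg[of i "real n" k] by (auto simp: reachable_def less_le)
    then show ?thesis by simp
  qed
  then have "(\<lambda>n. \<Sum>k\<in>S. transition i (real n) k) \<longlonglongrightarrow> (\<Sum>k\<in>S. 0)"
    by (intro tendsto_sum)
  then have "(\<lambda>n. 1 :: real) \<longlonglongrightarrow> 0"
    using i by (simp add: sum_transition)
  then show False
    by (simp add: LIMSEQ_const_iff)
qed

text \<open>There are finitely many states and absorption probabilities are monotone in time, so
  some time h and some \<eta> > 0 serve all starting states. By the Chapman-Kolmogorov equation,
  each block of length h multiplies the survival probability by at most 1 - \<eta>.\<close>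

lemma survival_exponential:
  obtains c K where "c > 0" "\<And>i u. i \<in> S \<Longrightarrow> 0 \<le> u \<Longrightarrow> 1 - transition i u \<Delta> \<le> K * exp (- c * u)"
proof -
  have "\<forall>i\<in>S. \<exists>m. transition i (real m) \<Delta> > 0"
    using absorbing_reachable by (auto simp: reachable_def)
  then obtain m where m: "\<And>i. i \<in> S \<Longrightarrow> transition i (real (m i)) \<Delta> > 0"
    by metis
  \<comment> \<open>\<open>Suc\<close> keeps h positive even if all the chosen times are 0.\<close>
  define h where "h = real (Suc (Max (m ` S)))"
  have "h > 0"
    by (simp add: h_def)
  define \<eta> where "\<eta> = Min ((\<lambda>i. transition i h \<Delta>) ` S)"
  have S: "S \<noteq> {}" "finite S"
    using absorbing_state finite_states by auto
  have "0 < transition i h \<Delta>" if "i \<in> S" for i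
  proof -
    have "m i \<le> Max (m ` S)"
      using that S by simp
    then have "real (m i) \<le> h"
      by (simp add: h_def)
    then show ?thesis
      using transition_absorbing_mono[of i "real (m i)" h] m[OF that] that by simp
  qed
  then have "\<eta> > 0"
    using S by (simp add: \<eta>_def)
  have \<eta>: "\<eta> \<le> transition i h \<Delta>" if "i \<in> S" for i
    using S that by (simp add: \<eta>_def)
  have "\<eta> \<le> 1"
    using \<eta> absorbing_state transition_le_1[of \<Delta> h \<Delta>] by force
  have step: "1 - transition i (s + h) \<Delta> \<le> (1 - \<eta>) * (1 - transition i s \<Delta>)"
    if "i \<in> S" "0 \<le> s" for i s
  proof -
    have "1 - transition i (s + h) \<Delta> = (\<Sum>k\<in>S. transition i s k * (1 - transition k h \<Delta>))"
      using that \<open>h > 0\<close> absorbing_state sum_transition[of i s]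
      by (simp add: chapman_kolmogorov right_diff_distrib sum_subtractf)
    also have "\<dots> = (\<Sum>k\<in>S - {\<Delta>}. transition i s k * (1 - transition k h \<Delta>))"
      using S absorbing_state \<open>h > 0\<close>
      by (intro sum.mono_neutral_right) (auto simp: transition_absorbing)
    also have "\<dots> \<le> (\<Sum>k\<in>S - {\<Delta>}. transition i s k * (1 - \<eta>))"
      using \<eta> by (intro sum_mono mult_left_mono) auto
    also have "\<dots> = (1 - \<eta>) * (\<Sum>k\<in>S - {\<Delta>}. transition i s k)"
      by (simp add: sum_distrib_left mult.commute)
    also have "(\<Sum>k\<in>S - {\<Delta>}. transition i s k) = 1 - transition i s \<Delta>"
      using S absorbing_state sum_transition[OF that] by (simp add: sum_diff1)
    finally show ?thesis .
  qed
  have geometric: "1 - transition i (real n * h) \<Delta> \<le> (1 - \<eta>) ^ n" if "i \<in> S" for i n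
  proof (induction n)
    case 0
    then show ?case by simp
  next
    case (Suc n)
    have "1 - transition i (real n * h + h) \<Delta> \<le> (1 - \<eta>) * (1 - transition i (real n * h) \<Delta>)"
      using that \<open>h > 0\<close> by (intro step) auto
    also have "\<dots> \<le> (1 - \<eta>) * (1 - \<eta>) ^ n"
      using Suc \<open>\<eta> \<le> 1\<close> by (intro mult_left_mono) auto
    finally show ?case
      by (simp add: algebra_simps)
  qed
  show ?thesis
  \<comment> \<open>Bounding 1 - \<eta> by exp (- \<eta>) avoids a logarithm, which would break down
    at \<eta> = 1; the factor exp \<eta> makes up for rounding u / h down to an integer.\<close>
  proof (rule that[of "\<eta> / h" "exp \<eta>"])
    show "\<eta> / h > 0"
      using \<open>\<eta> > 0\<close> \<open>h > 0\<close> by simp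
    fix i u assume i: "i \<in> S" and u: "0 \<le> (u::real)"
    define n where "n = nat \<lfloor>u / h\<rfloor>"
    have "0 \<le> u / h"
      using u \<open>h > 0\<close> by simp
    then have n: "real n \<le> u / h" "u / h \<le> real n + 1"
      by (auto simp: n_def)
    have "1 - transition i u \<Delta> \<le> 1 - transition i (real n * h) \<Delta>"
      using n(1) i \<open>h > 0\<close> by (intro diff_left_mono transition_absorbing_mono) (auto simp: field_simps)
    also have "\<dots> \<le> (1 - \<eta>) ^ n"
      using geometric i by simp
    also have "\<dots> \<le> exp (- \<eta>) ^ n"
      using \<open>\<eta> \<le> 1\<close> exp_ge_add_one_self[of "- \<eta>"] by (intro power_mono) auto
    also have "\<dots> = exp (real n * - \<eta>)"
      by (simp only: exp_of_nat_mult)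
    also have "\<dots> \<le> exp (\<eta> - \<eta> / h * u)"
      using mult_left_mono[OF n(2), of \<eta>] \<open>\<eta> > 0\<close> by (simp add: algebra_simps)
    also have "\<dots> = exp \<eta> * exp (- (\<eta> / h) * u)"
      by (simp add: exp_diff exp_minus field_simps)
    finally show "1 - transition i u \<Delta> \<le> exp \<eta> * exp (- (\<eta> / h) * u)" .
  qed
qed

text \<open>The infimum runs over uncountably many times. By right-continuity a path that is in
  \<open>\<Delta>\<close> before time b is also there at a rational time before b, which makes the
  strict inequality a countable union; the weak one is a countable intersection of strict
  ones.\<close>

lemma absorption_time_event:
  assumes "i \<in> S"
  shows "{\<omega> \<in> space (P i). absorption_time J \<Delta> \<omega> \<le> ereal u} \<in> sets (P i)"
proof -
  define E where "E b = (\<Union>r\<in>{r. 0 \<le> real_of_rat r \<and> real_of_rat r < b}.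
    {\<omega> \<in> space (P i). J (real_of_rat r) \<omega> = \<Delta>})" for b
  have "absorption_time J \<Delta> \<omega> < ereal b \<longleftrightarrow> \<omega> \<in> E b" if "\<omega> \<in> space (P i)" for b \<omega>
  proof
    assume "absorption_time J \<Delta> \<omega> < ereal b"
    then obtain t where t: "0 \<le> t" "J t \<omega> = \<Delta>" "t < b"
      by (auto simp: absorption_time_def INF_less_iff)
    have "eventually (\<lambda>s. J s \<omega> = J t \<omega>) (at_right t)"
      using right_continuous assms that t(1) by blast
    then obtain d where d: "d > t" "\<And>s. t < s \<Longrightarrow> s < d \<Longrightarrow> J s \<omega> = J t \<omega>"
      by (auto simp: eventually_at_right_field)
    obtain r where "t < real_of_rat r" "real_of_rat r < min b d"
      using of_rat_dense[of t "min b d"] d t by auto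
    then have "0 \<le> real_of_rat r" "real_of_rat r < b" "J (real_of_rat r) \<omega> = \<Delta>"
      using d(2)[of "real_of_rat r"] t(1,2) by (linarith, auto)
    then show "\<omega> \<in> E b"
      using that by (auto simp: E_def)
  next
    assume "\<omega> \<in> E b"
    then obtain t :: real where "0 \<le> t" "t < b" "J t \<omega> = \<Delta>"
      unfolding E_def by blast
    then show "absorption_time J \<Delta> \<omega> < ereal b"
      by (auto simp: absorption_time_def INF_less_iff)
  qed
  moreover have "absorption_time J \<Delta> \<omega> \<le> ereal u \<longleftrightarrow>
      (\<forall>n. absorption_time J \<Delta> \<omega> < ereal (u + 1 / real (Suc n)))" for \<omega>
  proof
    assume "absorption_time J \<Delta> \<omega> \<le> ereal u"
    then show "\<forall>n. absorption_time J \<Delta> \<omega> < ereal (u + 1 / real (Suc n))"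
      by (auto intro: le_less_trans)
  next
    assume *: "\<forall>n. absorption_time J \<Delta> \<omega> < ereal (u + 1 / real (Suc n))"
    have "(\<lambda>n. u + 1 / real (Suc n)) \<longlonglongrightarrow> u + 0"
      using LIMSEQ_Suc[OF lim_1_over_n[where 'a = real]] by (intro tendsto_add tendsto_const) simp
    then have "(\<lambda>n. ereal (u + 1 / real (Suc n))) \<longlonglongrightarrow> ereal u"
      by simp
    then show "absorption_time J \<Delta> \<omega> \<le> ereal u"
      by (rule tendsto_lowerbound) (use * in \<open>auto intro!: always_eventually less_imp_le\<close>)
  qed
  ultimately have "{\<omega> \<in> space (P i). absorption_time J \<Delta> \<omega> \<le> ereal u}
      = (\<Inter>n. E (u + 1 / real (Suc n)) \<inter> space (P i))"
    by auto
  also have "\<dots> \<in> sets (P i)"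
    unfolding E_def using assms absorbing_state
    by (intro sets.countable_INT' sets.Int sets.countable_UN' state_event)
      (auto simp: countable_rat)
  finally show ?thesis .
qed

end

lemma phase_type_tail:
  assumes "phase_type S P J \<Delta> \<alpha> F"
  obtains c K where "c > 0" "\<And>u. 0 \<le> u \<Longrightarrow> 1 - F u \<le> K * exp (- c * u)"
proof -
  interpret absorbing_jump_process S P J \<Delta>
    using assms by (simp add: phase_type_def)
  have \<alpha>: "set_pmf \<alpha> \<subseteq> S"
    and F: "\<And>u. F u = (\<Sum>i\<in>S. pmf \<alpha> i *
        measure (P i) {\<omega> \<in> space (P i). absorption_time J \<Delta> \<omega> \<le> ereal u})"
    using assms by (auto simp: phase_type_def)
  obtain c K where c: "c > 0"
    and K: "\<And>i u. i \<in> S \<Longrightarrow> 0 \<le> u \<Longrightarrow> 1 - transition i u \<Delta> \<le> K * exp (- c * u)"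
    using survival_exponential by metis
  show ?thesis
  proof (rule that[OF c])
    fix u :: real assume u: "0 \<le> u"
    have sum1: "(\<Sum>i\<in>S. pmf \<alpha> i) = 1"
      using \<alpha> finite_states by (rule sum_pmf_eq_1[rotated])
    have "1 - F u = (\<Sum>i\<in>S. pmf \<alpha> i *
        (1 - measure (P i) {\<omega> \<in> space (P i). absorption_time J \<Delta> \<omega> \<le> ereal u}))"
      using sum1 by (simp add: F right_diff_distrib sum_subtractf)
    also have "\<dots> \<le> (\<Sum>i\<in>S. pmf \<alpha> i * (K * exp (- c * u)))"
    proof (intro sum_mono mult_left_mono)
      fix i assume i: "i \<in> S"
      interpret prob_space "P i" using prob_space_P i by simp
      \<comment> \<open>If the process is in \<open>\<Delta>\<close> at time u, then u itself
        belongs to the set whose infimum is the absorption time.\<close>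
      have "transition i u \<Delta> \<le> prob {\<omega> \<in> space (P i). absorption_time J \<Delta> \<omega> \<le> ereal u}"
        unfolding transition_def using absorption_time_event[OF i] u
        by (intro finite_measure_mono) (auto simp: absorption_time_def intro: INF_lower2)
      then show "1 - prob {\<omega> \<in> space (P i). absorption_time J \<Delta> \<omega> \<le> ereal u} \<le> K * exp (- c * u)"
        using K[OF i u] by linarith
    qed simp
    also have "\<dots> = K * exp (- c * u)"
      using sum1 by (simp add: sum_distrib_right[symmetric])
    finally show "1 - F u \<le> K * exp (- c * u)" .
  qed
qed

lemma phase_type_negative:
  assumes "phase_type S P J \<Delta> \<alpha> F" "u < 0"
  shows "F u = 0"
proof -
  have "0 \<le> absorption_time J \<Delta> \<omega>" for \<omega>
    unfolding absorption_time_def by (rule INF_greatest) auto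
  then have "\<not> absorption_time J \<Delta> \<omega> \<le> ereal u" for \<omega>
    using assms(2) by (metis ereal_less(2) ereal_less_eq(5) leD order_trans)
  then show ?thesis
    using assms(1) by (simp add: phase_type_def)
qed

subsection \<open>The excess distribution of the mixture\<close>

context prob_space
begin

lemma cdf_zero_imp_AE_nonneg:
  assumes [measurable]: "random_variable borel X" and "\<And>x. x < 0 \<Longrightarrow> cdf (distr M borel X) x = 0"
  shows "AE \<omega> in M. 0 \<le> X \<omega>"
proof -
  interpret D: half_line_distribution "distr M borel X"
    using assms by (intro half_line_distributionI real_distribution_distr)
  show ?thesis
    using D.AE_nonneg by (subst (asm) AE_distr_iff) auto
qed

text \<open>Tonelli for the set of pairs with x < X. The set \<open>I\<close> is left open because
  both [u, \<infinity>) and [0, u] are needed.\<close>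

lemma nn_integral_one_minus_cdf:
  assumes [measurable]: "random_variable borel X" "I \<in> sets borel"
  shows "(\<integral>\<^sup>+x. indicator I x * ennreal (1 - cdf (distr M borel X) x) \<partial>lborel)
    = (\<integral>\<^sup>+\<omega>. emeasure lborel {x \<in> I. x < X \<omega>} \<partial>M)"
proof -
  interpret L: pair_sigma_finite lborel M ..
  have "(\<integral>\<^sup>+x. indicator I x * ennreal (1 - cdf (distr M borel X) x) \<partial>lborel)
      = (\<integral>\<^sup>+x. (\<integral>\<^sup>+\<omega>. indicator {x \<in> I. x < X \<omega>} x \<partial>M) \<partial>lborel)"
  proof (rule nn_integral_cong)
    fix x
    have "1 - cdf (distr M borel X) x = 1 - prob {\<omega> \<in> space M. X \<omega> \<le> x}"
      by (simp add: cdf_def measure_distr vimage_def Int_def conj_commute)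
    also have "\<dots> = prob {\<omega> \<in> space M. \<not> X \<omega> \<le> x}"
      by (rule prob_neg[symmetric]) measurable
    finally have "ennreal (1 - cdf (distr M borel X) x) = emeasure M {\<omega> \<in> space M. x < X \<omega>}"
      by (simp add: emeasure_eq_measure not_le)
    also have "\<dots> = (\<integral>\<^sup>+\<omega>. indicator {\<omega> \<in> space M. x < X \<omega>} \<omega> \<partial>M)"
      by simp
    finally have "indicator I x * ennreal (1 - cdf (distr M borel X) x)
        = (\<integral>\<^sup>+\<omega>. indicator I x * indicator {\<omega> \<in> space M. x < X \<omega>} \<omega> \<partial>M)"
      by (simp add: nn_integral_cmult)
    also have "\<dots> = (\<integral>\<^sup>+\<omega>. indicator {x \<in> I. x < X \<omega>} x \<partial>M)"
      by (intro nn_integral_cong) (auto split: split_indicator)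
    finally show "indicator I x * ennreal (1 - cdf (distr M borel X) x)
        = (\<integral>\<^sup>+\<omega>. indicator {x \<in> I. x < X \<omega>} x \<partial>M)" .
  qed
  also have "\<dots> = (\<integral>\<^sup>+\<omega>. (\<integral>\<^sup>+x. indicator {x \<in> I. x < X \<omega>} x \<partial>lborel) \<partial>M)"
    by (rule L.Fubini'[symmetric]) measurable
  also have "\<dots> = (\<integral>\<^sup>+\<omega>. emeasure lborel {x \<in> I. x < X \<omega>} \<partial>M)"
    by (intro nn_integral_cong nn_integral_indicator) measurable
  finally show ?thesis .
qed

context
  fixes X :: "'a \<Rightarrow> real" and F :: "real \<Rightarrow> real"
  assumes X [measurable]: "random_variable borel X"
    and F: "cdf (distr M borel X) = F"
begin

lemma borel_measurable_one_minus_cdf [measurable]: "(\<lambda>x. 1 - F x) \<in> borel_measurable borel"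
proof -
  interpret D: real_distribution "distr M borel X"
    by simp
  have "F \<in> borel_measurable borel"
    using D.cdf_nondecreasing F by (intro borel_measurable_mono) (auto simp: mono_def)
  then show ?thesis by simp
qed

lemma cdf_le_1: "F x \<le> 1"
proof -
  interpret D: real_distribution "distr M borel X"
    by simp
  show ?thesis using D.cdf_bounded_prob[of x] F by simp
qed

lemma expectation_excess_le:
  assumes "0 < c" and le: "\<And>x. u \<le> x \<Longrightarrow> 1 - F x \<le> K * exp (- c * x)"
  shows "expectation (\<lambda>\<omega>. max 0 (X \<omega> - u)) \<le> K / c * exp (- c * u)"
proof -
  have "0 \<le> K * exp (- c * u)"
    using le[of u] cdf_le_1[of u] by simp
  then have "0 \<le> K"
    by (simp add: zero_le_mult_iff)
  have "(\<integral>\<^sup>+\<omega>. ennreal (max 0 (X \<omega> - u)) \<partial>M) = (\<integral>\<^sup>+\<omega>. emeasure lborel {x \<in> {u..}. x < X \<omega>} \<partial>M)"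
  proof (intro nn_integral_cong)
    fix \<omega>
    \<comment> \<open>The maximum covers the case that X is below u, where the interval is
      empty.\<close>
    have "{x \<in> {u..}. x < X \<omega>} = {u..<max u (X \<omega>)}"
      by auto
    then show "ennreal (max 0 (X \<omega> - u)) = emeasure lborel {x \<in> {u..}. x < X \<omega>}"
      by (simp only: emeasure_lborel_Ico[OF max.cobounded1]) (simp add: max_def)
  qed
  also have "\<dots> = (\<integral>\<^sup>+x. indicator {u..} x * ennreal (1 - F x) \<partial>lborel)"
    using nn_integral_one_minus_cdf[OF X, of "{u..}"] by (simp add: F)
  also have "\<dots> \<le> (\<integral>\<^sup>+x. ennreal (K * exp (- c * x)) * indicator {u..} x \<partial>lborel)"
    using le by (intro nn_integral_mono) (auto split: split_indicator intro: ennreal_leI)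
  also have "\<dots> = ennreal (0 - (- K / c * exp (- c * u)))"
  proof (rule nn_integral_FTC_atLeast)
    show "((\<lambda>x. - K / c * exp (- c * x)) \<longlongrightarrow> 0) at_top"
      using \<open>0 < c\<close> by (intro tendsto_mult_right_zero filterlim_compose[OF exp_at_bot]
        filterlim_tendsto_neg_mult_at_bot[OF tendsto_const _ filterlim_ident]) auto
    show "((\<lambda>x. - K / c * exp (- c * x)) has_real_derivative K * exp (- c * x)) (at x)" for x
      using \<open>0 < c\<close> by (auto intro!: derivative_eq_intros)
  qed (use \<open>0 \<le> K\<close> in auto)
  finally have "(\<integral>\<^sup>+\<omega>. ennreal (max 0 (X \<omega> - u)) \<partial>M) \<le> ennreal (K / c * exp (- c * u))"
    by simp
  then have "enn2real (\<integral>\<^sup>+\<omega>. ennreal (max 0 (X \<omega> - u)) \<partial>M) \<le> K / c * exp (- c * u)"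
    using \<open>0 \<le> K\<close> \<open>0 < c\<close> by (intro enn2real_leI) auto
  then show ?thesis
    by (subst integral_eq_nn_integral) auto
qed

context
  assumes F0: "\<And>x. x < 0 \<Longrightarrow> F x = 0" and int: "integrable M X"
begin

text \<open>The integral of the tail over [0, u] is the expectation of min X u, and X = min X u +
  max 0 (X - u). The missing part of the integral thus becomes an expectation, to which
  \<open>expectation_excess_le\<close> applies.\<close>

lemma
  assumes "0 \<le> u"
  shows set_integrable_one_minus_cdf: "set_integrable lborel {0..u} (\<lambda>x. 1 - F x)"
    and set_lebesgue_integral_one_minus_cdf:
      "expectation X - (LBINT x:{0..u}. 1 - F x) = expectation (\<lambda>\<omega>. max 0 (X \<omega> - u))"
proof -
  have pos: "AE \<omega> in M. 0 \<le> X \<omega>"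
    using F0 F by (intro cdf_zero_imp_AE_nonneg) auto
  have int': "integrable M (\<lambda>\<omega>. min (X \<omega>) u)" "integrable M (\<lambda>\<omega>. max 0 (X \<omega> - u))"
    using int by (auto intro!: integrable_min integrable_max)
  have "(\<integral>\<^sup>+x. ennreal (indicator {0..u} x *\<^sub>R (1 - F x)) \<partial>lborel)
      = (\<integral>\<^sup>+x. indicator {0..u} x * ennreal (1 - F x) \<partial>lborel)"
    by (intro nn_integral_cong) (auto split: split_indicator)
  also have "\<dots> = (\<integral>\<^sup>+\<omega>. emeasure lborel {x \<in> {0..u}. x < X \<omega>} \<partial>M)"
    using nn_integral_one_minus_cdf[OF X, of "{0..u}"] by (simp add: F)
  also have "\<dots> = (\<integral>\<^sup>+\<omega>. ennreal (min (X \<omega>) u) \<partial>M)"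
    using pos
  proof (intro nn_integral_cong_AE, eventually_elim)
    fix \<omega> assume "0 \<le> X \<omega>"
    then have "{x \<in> {0..u}. x < X \<omega>} = (if X \<omega> \<le> u then {0..<X \<omega>} else {0..u})"
      by auto
    then show "emeasure lborel {x \<in> {0..u}. x < X \<omega>} = ennreal (min (X \<omega>) u)"
      using \<open>0 \<le> X \<omega>\<close> assms by (simp add: min_def)
  qed
  also have "\<dots> = ennreal (expectation (\<lambda>\<omega>. min (X \<omega>) u))"
    using int'(1) assms by (intro nn_integral_eq_integral) (use pos in \<open>auto simp: min_def\<close>)
  finally have nn: "(\<integral>\<^sup>+x. ennreal (indicator {0..u} x *\<^sub>R (1 - F x)) \<partial>lborel)
      = ennreal (expectation (\<lambda>\<omega>. min (X \<omega>) u))" .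
  have nonneg: "AE x in lborel. 0 \<le> indicator {0..u} x *\<^sub>R (1 - F x)"
    using cdf_le_1 by auto
  have meas: "(\<lambda>x. indicator {0..u} x *\<^sub>R (1 - F x)) \<in> borel_measurable lborel"
    by measurable
  show "set_integrable lborel {0..u} (\<lambda>x. 1 - F x)"
    unfolding set_integrable_def
    using meas nonneg nn by (intro integrableI_nonneg) auto
  have "0 \<le> expectation (\<lambda>\<omega>. min (X \<omega>) u)"
    using pos assms by (intro integral_nonneg_AE) auto
  then have "(LBINT x:{0..u}. 1 - F x) = expectation (\<lambda>\<omega>. min (X \<omega>) u)"
    unfolding set_lebesgue_integral_def
    by (subst integral_eq_nn_integral[OF meas nonneg], subst nn) simp
  also have "\<dots> = expectation (\<lambda>\<omega>. X \<omega> - max 0 (X \<omega> - u))"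
    by (intro Bochner_Integration.integral_cong) auto
  also have "\<dots> = expectation X - expectation (\<lambda>\<omega>. max 0 (X \<omega> - u))"
    using int int' by simp
  finally show "expectation X - (LBINT x:{0..u}. 1 - F x) = expectation (\<lambda>\<omega>. max 0 (X \<omega> - u))"
    by simp
qed

end

end

end

text \<open>Integration is linear in the mixture: 1 - G^e equals
  \<open>\<epsilon> * \<mu>C / m\<close> times the tail of F_h^e plus a remainder \<open>r\<close>
  from the phase-type part. The remainder is exponentially small, and a subexponential tail is
  not.\<close>

lemma mixture_excess_tail:
  fixes S :: "'s set" and MB :: "'d measure" and MC :: "'e measure"
  assumes eps: "0 < \<epsilon>" "\<epsilon> < 1"
    and Fp: "phase_type S P J \<Delta> \<alpha> Fp"
    and B: "prob_space MB" "B \<in> borel_measurable MB" "cdf (distr MB borel B) = Fp"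
      "integrable MB B" "\<mu>B = integral\<^sup>L MB B"
    and Fh: "subexponential Fh"
    and C: "prob_space MC" "C \<in> borel_measurable MC" "cdf (distr MC borel C) = Fh"
      "integrable MC C" "\<mu>C = integral\<^sup>L MC C"
    and G: "G = (\<lambda>u. (1 - \<epsilon>) * Fp u + \<epsilon> * Fh u)"
    and Fhe: "Fhe = excess_df \<mu>C Fh" "subexponential Fhe"
    and m: "m = (1 - \<epsilon>) * \<mu>B + \<epsilon> * \<mu>C"
  shows "0 < \<mu>C" "0 < m" "0 < 1 - excess_df m G u"
    and "((\<lambda>u. (1 - excess_df m G u) / (1 - Fhe u)) \<longlongrightarrow> \<epsilon> * \<mu>C / m) at_top"
proof -
  interpret B: prob_space MB by fact
  interpret C: prob_space MC by fact
  interpret H: subexponential_distribution "interval_measure Fhe"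
    using Fhe(2) by (rule subexponential_imp_subexponential_distribution)
  have tail: "tail (interval_measure Fhe) u = 1 - Fhe u" for u
    using Fhe(2) by (rule subexponential_imp_subexponential_distribution)
  have Fp0: "Fp x = 0" if "x < 0" for x
    using phase_type_negative[OF Fp that] .
  have Fh0: "Fh x = 0" if "x < 0" for x
    using Fh that by (simp add: subexponential_def df_nonneg_def)
  have "\<mu>C \<ge> 0"
    using C.cdf_zero_imp_AE_nonneg[OF C(2)] Fh0 C(3) unfolding C(5)
    by (intro integral_nonneg_AE) simp
  \<comment> \<open>With \<open>\<mu>C = 0\<close> the factor 1 / 0 = 0 would make
    \<open>Fhe\<close> vanish identically, against its limit 1.\<close>
  moreover have "\<mu>C \<noteq> 0"
  proof
    assume "\<mu>C = 0"
    then have "Fhe = (\<lambda>_. 0)"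
      by (simp add: Fhe(1) excess_df_def fun_eq_iff)
    then have "((\<lambda>_::real. 0::real) \<longlongrightarrow> 1) at_top"
      using Fhe(2) by (simp add: subexponential_def df_nonneg_def)
    then show False
      by (simp add: tendsto_const_iff)
  qed
  ultimately show "\<mu>C > 0"
    by simp
  have "\<mu>B \<ge> 0"
    using B.cdf_zero_imp_AE_nonneg[OF B(2)] Fp0 B(3) unfolding B(5)
    by (intro integral_nonneg_AE) simp
  then show "m > 0"
    using eps \<open>\<mu>C > 0\<close> by (simp add: m add_nonneg_pos)
  define r where "r u = (1 - \<epsilon>) / m * B.expectation (\<lambda>\<omega>. max 0 (B \<omega> - u))" for u
  have r: "0 \<le> r u" for u
    using eps \<open>m > 0\<close> by (simp add: r_def)
  have eq: "1 - excess_df m G u = \<epsilon> * \<mu>C / m * (1 - Fhe u) + r u" if "0 \<le> u" for u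
  proof -
    define IB where "IB = (LBINT x:{0..u}. 1 - Fp x)"
    define IC where "IC = (LBINT x:{0..u}. 1 - Fh x)"
    have "(LBINT x:{0..u}. 1 - G x)
        = (LBINT x:{0..u}. (1 - \<epsilon>) * (1 - Fp x) + \<epsilon> * (1 - Fh x))"
      by (simp add: G algebra_simps)
    also have "\<dots> = (1 - \<epsilon>) * IB + \<epsilon> * IC"
      unfolding IB_def IC_def
      using B.set_integrable_one_minus_cdf[OF B(2,3) Fp0 B(4) that]
        C.set_integrable_one_minus_cdf[OF C(2,3) Fh0 C(4) that]
      by (subst set_integral_add) auto
    finally have "1 - excess_df m G u = ((1 - \<epsilon>) * (\<mu>B - IB) + \<epsilon> * (\<mu>C - IC)) / m"
      using that \<open>m > 0\<close> by (simp add: excess_df_def field_simps) (simp add: m algebra_simps)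
    moreover have "\<mu>B - IB = B.expectation (\<lambda>\<omega>. max 0 (B \<omega> - u))"
      unfolding IB_def B(5) by (rule B.set_lebesgue_integral_one_minus_cdf[OF B(2,3) Fp0 B(4) that])
    moreover have "\<mu>C - IC = \<mu>C * (1 - Fhe u)"
      using that \<open>\<mu>C > 0\<close> by (simp add: Fhe(1) excess_df_def IC_def field_simps)
    ultimately show ?thesis
      by (simp add: r_def add_divide_distrib)
  qed
  show "0 < 1 - excess_df m G u"
  proof (cases "0 \<le> u")
    case True
    have "0 < \<epsilon> * \<mu>C / m * (1 - Fhe u)"
      using H.tail_pos[of u] tail[of u] eps \<open>\<mu>C > 0\<close> \<open>m > 0\<close> by simp
    then show ?thesis
      using eq[OF True] r[of u] by linarith
  qed (simp add: excess_df_def)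
  obtain c K where c: "c > 0" and K: "\<And>u. 0 \<le> u \<Longrightarrow> 1 - Fp u \<le> K * exp (- c * u)"
    using phase_type_tail[OF Fp] by metis
  have "((\<lambda>u. r u / (1 - Fhe u)) \<longlongrightarrow> 0) at_top"
  proof (rule tendsto_sandwich[OF _ _ tendsto_const])
    show "eventually (\<lambda>u. 0 \<le> r u / (1 - Fhe u)) at_top"
      using r H.tail_pos by (intro always_eventually allI divide_nonneg_pos) (auto simp: tail[symmetric])
    show "eventually (\<lambda>u. r u / (1 - Fhe u)
        \<le> (1 - \<epsilon>) / m * (K / c) * (exp (- c * u) / tail (interval_measure Fhe) u)) at_top"
      using eventually_ge_at_top[of 0]
    proof eventually_elim
      fix u :: real assume "0 \<le> u"
      have "r u \<le> (1 - \<epsilon>) / m * (K / c * exp (- c * u))"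
        unfolding r_def using eps \<open>m > 0\<close> K \<open>0 \<le> u\<close> c
        by (intro mult_left_mono B.expectation_excess_le[OF B(2,3)]) auto
      then have "r u / tail (interval_measure Fhe) u
          \<le> (1 - \<epsilon>) / m * (K / c * exp (- c * u)) / tail (interval_measure Fhe) u"
        by (intro divide_right_mono) auto
      then show "r u / (1 - Fhe u)
          \<le> (1 - \<epsilon>) / m * (K / c) * (exp (- c * u) / tail (interval_measure Fhe) u)"
        by (simp add: tail mult.assoc)
    qed
    show "((\<lambda>u. (1 - \<epsilon>) / m * (K / c) * (exp (- c * u) / tail (interval_measure Fhe) u)) \<longlongrightarrow> 0) at_top"
      by (rule tendsto_mult_right_zero) (rule H.exponential_tail_negligible[OF c])
  qed
  then have "((\<lambda>u. \<epsilon> * \<mu>C / m + r u / (1 - Fhe u)) \<longlongrightarrow> \<epsilon> * \<mu>C / m + 0) at_top"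
    by (intro tendsto_intros)
  moreover have "eventually (\<lambda>u. \<epsilon> * \<mu>C / m + r u / (1 - Fhe u)
      = (1 - excess_df m G u) / (1 - Fhe u)) at_top"
    using eventually_ge_at_top[of 0]
  proof eventually_elim
    fix u :: real assume "0 \<le> u"
    then show "\<epsilon> * \<mu>C / m + r u / (1 - Fhe u) = (1 - excess_df m G u) / (1 - Fhe u)"
      using H.tail_pos[of u] unfolding eq[OF \<open>0 \<le> u\<close>] tail by (simp add: add_divide_distrib)
  qed
  ultimately show "((\<lambda>u. (1 - excess_df m G u) / (1 - Fhe u)) \<longlongrightarrow> \<epsilon> * \<mu>C / m) at_top"
    by (simp add: Lim_transform_eventually)
qed

subsection \<open>Tail asymptotics of the geometric sum\<close>

locale subexponential_pk = pk_variables +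
  assumes \<rho>_pos: "0 < \<rho>" and \<rho>_less_1: "\<rho> < 1"
    and subexponential_excess: "subexponential_distribution (distr R borel (Ue 1))"
begin

abbreviation "D \<equiv> distr R borel (Ue 1)"

sublocale E: subexponential_distribution D
  by (rule subexponential_excess)

lemma measurable_Ue [measurable]: "1 \<le> k \<Longrightarrow> random_variable borel (Ue k)"
  using excess_indep by (auto simp: indep_vars_def)

lemma distr_Ue: "1 \<le> k \<Longrightarrow> distr R borel (Ue k) = D"
  using excess_distribution by (intro cdf_unique real_distribution_distr measurable_Ue) auto

lemma distr_sum_Ue: "distr R borel (\<lambda>\<omega>. \<Sum>k = 1..Suc n. Ue k \<omega>) = conv_iter D n"
proof (induction n)
  case 0
  then show ?case by simp
next
  case (Suc n)
  define I where "I = {1..Suc n}"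
  have I: "{1..Suc (Suc n)} = insert (Suc (Suc n)) I"
    by (auto simp: I_def)
  have [measurable]: "random_variable borel (Ue (Suc (Suc n)))"
    "random_variable borel (\<lambda>\<omega>. \<Sum>k\<in>I. Ue k \<omega>)"
    by (auto simp: I_def intro!: borel_measurable_sum measurable_Ue)
  have "indep_vars (\<lambda>_. borel) Ue (insert (Suc (Suc n)) I)"
    using excess_indep by (rule indep_vars_subset) (auto simp: I_def)
  then have "indep_var borel (Ue (Suc (Suc n))) borel (\<lambda>\<omega>. \<Sum>k\<in>I. Ue k \<omega>)"
    by (intro indep_vars_sum) (auto simp: I_def)
  then have "distr R borel (\<lambda>\<omega>. Ue (Suc (Suc n)) \<omega> + (\<Sum>k\<in>I. Ue k \<omega>))
      = (distr R borel (Ue (Suc (Suc n))) \<star> distr R borel (\<lambda>\<omega>. \<Sum>k\<in>I. Ue k \<omega>))"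
    by (intro sum_indep_random_variable) auto
  also have "\<dots> = conv_iter D (Suc n)"
    unfolding I_def Suc.IH conv_iter.simps by (subst distr_Ue) auto
  also have "(\<lambda>\<omega>. Ue (Suc (Suc n)) \<omega> + (\<Sum>k\<in>I. Ue k \<omega>)) = (\<lambda>\<omega>. \<Sum>k = 1..Suc (Suc n). Ue k \<omega>)"
    by (simp add: I_def add_ac)
  finally show ?case .
qed

lemma prob_N_Ue:
  assumes A: "A \<in> sets (PiM {1..} (\<lambda>_. borel))"
  shows "prob {\<omega> \<in> space R. N \<omega> = k \<and> (\<lambda>j\<in>{1..}. Ue j \<omega>) \<in> A}
    = (1 - \<rho>) * \<rho> ^ k * prob {\<omega> \<in> space R. (\<lambda>j\<in>{1..}. Ue j \<omega>) \<in> A}"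
proof -
  have "prob ((N -` {k} \<inter> space R) \<inter> ((\<lambda>\<omega>. \<lambda>j\<in>{1..}. Ue j \<omega>) -` A \<inter> space R))
      = prob (N -` {k} \<inter> space R) * prob ((\<lambda>\<omega>. \<lambda>j\<in>{1..}. Ue j \<omega>) -` A \<inter> space R)"
    using count_excess_indep A by (intro indep_setD) (auto simp: indep_rv_def)
  moreover have "(N -` {k} \<inter> space R) \<inter> ((\<lambda>\<omega>. \<lambda>j\<in>{1..}. Ue j \<omega>) -` A \<inter> space R)
      = {\<omega> \<in> space R. N \<omega> = k \<and> (\<lambda>j\<in>{1..}. Ue j \<omega>) \<in> A}"
    "(\<lambda>\<omega>. \<lambda>j\<in>{1..}. Ue j \<omega>) -` A \<inter> space R = {\<omega> \<in> space R. (\<lambda>j\<in>{1..}. Ue j \<omega>) \<in> A}"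
    "N -` {k} \<inter> space R = {\<omega> \<in> space R. N \<omega> = k}"
    by auto
  ultimately show ?thesis
    by (simp add: geometric)
qed

lemma measurable_count_Ue: "(\<lambda>\<omega>. \<lambda>j\<in>{1..}. Ue j \<omega>) \<in> measurable R (PiM {1..} (\<lambda>_. borel))"
  using count_excess_indep by (simp add: indep_rv_def)

lemma prob_sum_gt:
  "prob {\<omega> \<in> space R. (\<Sum>j = 1..k + 2. Ue j \<omega>) > u} = tail (conv_iter D (Suc k)) u"
proof -
  have [measurable]: "random_variable borel (\<lambda>\<omega>. \<Sum>j = 1..Suc (Suc k). Ue j \<omega>)"
    by (intro borel_measurable_sum measurable_Ue) auto
  have "tail (conv_iter D (Suc k)) u = measure (distr R borel (\<lambda>\<omega>. \<Sum>j = 1..Suc (Suc k). Ue j \<omega>)) {u<..}"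
    by (simp only: tail_def distr_sum_Ue)
  also have "\<dots> = prob {\<omega> \<in> space R. (\<Sum>j = 1..Suc (Suc k). Ue j \<omega>) > u}"
    by (simp add: measure_distr vimage_def Int_def conj_commute del: sum.cl_ivl_Suc)
  finally show ?thesis
    by (simp only: add_2_eq_Suc')
qed

text \<open>On N = k the number of summands is fixed, so V > u becomes an event about the sequence
  of excess variables alone and independence from N applies. There are k + 2 summands, hence the
  index \<open>Suc k\<close> of \<open>conv_iter\<close>.\<close>

lemma pk_V_event: "{\<omega> \<in> space R. pk_V N Ue \<omega> > u} \<in> events"
  and prob_pk_V: "(\<lambda>k. (1 - \<rho>) * \<rho> ^ k * tail (conv_iter D (Suc k)) u)
    sums prob {\<omega> \<in> space R. pk_V N Ue \<omega> > u}"
proof -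
  define A where "A k = {x \<in> space (PiM {1..} (\<lambda>_. borel)). (\<Sum>j = 1..k + 2. x j) > u}" for k :: nat
  have A: "A k \<in> sets (PiM {1..} (\<lambda>_. borel))" for k
    unfolding A_def
    by (intro predE borel_measurable_pred_less borel_measurable_const borel_measurable_sum
        measurable_component_singleton) auto
  have mem: "(\<lambda>j\<in>{1..}. Ue j \<omega>) \<in> A k \<longleftrightarrow> (\<Sum>j = 1..k + 2. Ue j \<omega>) > u" for \<omega> k
    by (simp add: A_def space_PiM del: sum.cl_ivl_Suc add_2_eq_Suc')
  define W where "W k = {\<omega> \<in> space R. N \<omega> = k \<and> (\<lambda>j\<in>{1..}. Ue j \<omega>) \<in> A k}" for k
  have W: "W k \<in> events" for k
  proof -
    have "W k = (N -` {k} \<inter> space R) \<inter> ((\<lambda>\<omega>. \<lambda>j\<in>{1..}. Ue j \<omega>) -` A k \<inter> space R)"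
      by (auto simp: W_def)
    also have "\<dots> \<in> events"
      by (intro sets.Int measurable_sets[OF measurable_N] measurable_sets[OF measurable_count_Ue] A) simp
    finally show ?thesis .
  qed
  have UN: "(\<Union>k. W k) = {\<omega> \<in> space R. pk_V N Ue \<omega> > u}"
    unfolding W_def mem pk_V_def by auto
  show "{\<omega> \<in> space R. pk_V N Ue \<omega> > u} \<in> events"
    unfolding UN[symmetric] using W by auto
  have "(\<lambda>k. prob (W k)) sums prob (\<Union>k. W k)"
    using W by (intro finite_measure_UNION) (auto simp: disjoint_family_on_def W_def)
  moreover have "prob (W k) = (1 - \<rho>) * \<rho> ^ k * tail (conv_iter D (Suc k)) u" for k
    unfolding W_def prob_N_Ue[OF A] unfolding mem prob_sum_gt ..
  ultimately show "(\<lambda>k. (1 - \<rho>) * \<rho> ^ k * tail (conv_iter D (Suc k)) u)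
      sums prob {\<omega> \<in> space R. pk_V N Ue \<omega> > u}"
    by (simp only: UN)
qed

text \<open>In the definition N is compared with n - 2 in the integers; N < n - 1 says the same with
  truncated subtraction, also for n = 1, where nothing qualifies. For nonnegative u, the value 0
  taken off the event never exceeds u.\<close>

lemma pk_Vn_gt_iff:
  assumes "0 \<le> u"
  shows "pk_Vn N Ue n \<omega> > u \<longleftrightarrow> N \<omega> < n - 1 \<and> (\<exists>j\<in>{1..N \<omega> + 2}. Ue j \<omega> > u)"
proof (cases "int (N \<omega>) \<le> int n - 2")
  case True
  then have "N \<omega> < n - 1" "pk_Vn N Ue n \<omega> = Max ((\<lambda>k. Ue k \<omega>) ` {1..N \<omega> + 2})"
    by (auto simp: pk_Vn_def)
  moreover have "u < Max ((\<lambda>k. Ue k \<omega>) ` {1..N \<omega> + 2}) \<longleftrightarrow> (\<exists>j\<in>{1..N \<omega> + 2}. Ue j \<omega> > u)"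
    by (subst Max_gr_iff) auto
  ultimately show ?thesis
    by (simp only: simp_thms)
next
  case False
  then have "\<not> N \<omega> < n - 1" "pk_Vn N Ue n \<omega> = 0"
    by (auto simp: pk_Vn_def)
  then show ?thesis
    using assms by simp
qed

lemma prob_max_gt:
  "prob {\<omega> \<in> space R. \<exists>j\<in>{1..k + 2}. Ue j \<omega> > u} = 1 - (1 - tail D u) ^ (k + 2)"
proof -
  have cdf: "prob (Ue j -` {..u} \<inter> space R) = 1 - tail D u" if "1 \<le> j" for j
  proof -
    have "prob (Ue j -` {..u} \<inter> space R) = measure (distr R borel (Ue j)) {..u}"
      using that by (intro measure_distr[symmetric]) auto
    also have "\<dots> = 1 - tail D u"
      unfolding distr_Ue[OF that] E.tail_eq_cdf cdf_def by simp
    finally show ?thesis .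
  qed
  have "{\<omega> \<in> space R. \<exists>j\<in>{1..k + 2}. Ue j \<omega> > u} = space R - (\<Inter>j\<in>{1..k + 2}. Ue j -` {..u} \<inter> space R)"
    by (auto simp: not_le)
  moreover have "(\<Inter>j\<in>{1..k + 2}. Ue j -` {..u} \<inter> space R) \<in> events"
    by (intro sets.finite_INT) (auto intro!: measurable_sets[OF measurable_Ue])
  moreover have "prob (\<Inter>j\<in>{1..k + 2}. Ue j -` {..u} \<inter> space R)
      = (\<Prod>j\<in>{1..k + 2}. prob (Ue j -` {..u} \<inter> space R))"
    by (intro indep_varsD[OF excess_indep]) auto
  moreover have "\<dots> = (\<Prod>j\<in>{1..k + 2}. 1 - tail D u)"
    by (intro prod.cong) (auto simp: cdf)
  ultimately show ?thesis
    by (simp add: prob_compl)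
qed

lemma
  assumes "0 \<le> u"
  shows pk_Vn_event: "{\<omega> \<in> space R. pk_Vn N Ue n \<omega> > u} \<in> events"
    and prob_pk_Vn: "prob {\<omega> \<in> space R. pk_Vn N Ue n \<omega> > u}
      = (\<Sum>k<n - 1. (1 - \<rho>) * \<rho> ^ k * (1 - (1 - tail D u) ^ (k + 2)))"
proof -
  define A where "A k = {x \<in> space (PiM {1..} (\<lambda>_. borel)). \<exists>j\<in>{1..k + 2}. x j > u}" for k :: nat
  have A: "A k \<in> sets (PiM {1..} (\<lambda>_. borel))" for k
    unfolding A_def
    by (intro predE pred_intros_finite borel_measurable_pred_less borel_measurable_const
        measurable_component_singleton) auto
  have mem: "(\<lambda>j\<in>{1..}. Ue j \<omega>) \<in> A k \<longleftrightarrow> (\<exists>j\<in>{1..k + 2}. Ue j \<omega> > u)" for \<omega> k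
    by (auto simp: A_def space_PiM)
  define W where "W k = {\<omega> \<in> space R. N \<omega> = k \<and> (\<lambda>j\<in>{1..}. Ue j \<omega>) \<in> A k}" for k
  have W: "W k \<in> events" for k
  proof -
    have "W k = (N -` {k} \<inter> space R) \<inter> ((\<lambda>\<omega>. \<lambda>j\<in>{1..}. Ue j \<omega>) -` A k \<inter> space R)"
      by (auto simp: W_def)
    also have "\<dots> \<in> events"
      by (intro sets.Int measurable_sets[OF measurable_N] measurable_sets[OF measurable_count_Ue] A) simp
    finally show ?thesis .
  qed
  have UN: "(\<Union>k<n - 1. W k) = {\<omega> \<in> space R. pk_Vn N Ue n \<omega> > u}"
    unfolding pk_Vn_gt_iff[OF assms] W_def mem by auto
  show "{\<omega> \<in> space R. pk_Vn N Ue n \<omega> > u} \<in> events"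
    unfolding UN[symmetric] using W by auto
  have "prob (\<Union>k<n - 1. W k) = (\<Sum>k<n - 1. prob (W k))"
    using W by (intro finite_measure_finite_Union) (auto simp: disjoint_family_on_def W_def)
  also have "\<dots> = (\<Sum>k<n - 1. (1 - \<rho>) * \<rho> ^ k * (1 - (1 - tail D u) ^ (k + 2)))"
    unfolding W_def prob_N_Ue[OF A] unfolding mem prob_max_gt ..
  finally show "prob {\<omega> \<in> space R. pk_Vn N Ue n \<omega> > u}
      = (\<Sum>k<n - 1. (1 - \<rho>) * \<rho> ^ k * (1 - (1 - tail D u) ^ (k + 2)))"
    by (simp only: UN)
qed

text \<open>Excess variables are almost surely nonnegative, so each summand is bounded by the sum.
  This nesting of the two events makes a control variate without its target impossible.\<close>

lemma AE_pk_Vn_imp_pk_V: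
  assumes "0 \<le> u"
  shows "AE \<omega> in R. pk_Vn N Ue n \<omega> > u \<longrightarrow> pk_V N Ue \<omega> > u"
proof -
  have "AE \<omega> in R. \<forall>k. 1 \<le> k \<longrightarrow> 0 \<le> Ue k \<omega>"
    unfolding AE_all_countable
  proof
    fix k
    show "AE \<omega> in R. 1 \<le> k \<longrightarrow> 0 \<le> Ue k \<omega>"
    proof (cases "1 \<le> k")
      case True
      have "AE x in distr R borel (Ue k). 0 \<le> x"
        unfolding distr_Ue[OF True] by (rule E.AE_nonneg)
      then show ?thesis
        using True by (subst (asm) AE_distr_iff) auto
    qed simp
  qed
  then show ?thesis
  proof eventually_elim
    fix \<omega> assume *: "\<forall>k. 1 \<le> k \<longrightarrow> 0 \<le> Ue k \<omega>"
    show "pk_Vn N Ue n \<omega> > u \<longrightarrow> pk_V N Ue \<omega> > u"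
    proof
      assume "pk_Vn N Ue n \<omega> > u"
      then obtain j where j: "j \<in> {1..N \<omega> + 2}" "Ue j \<omega> > u"
        using pk_Vn_gt_iff[OF assms] by auto
      have "Ue j \<omega> \<le> pk_V N Ue \<omega>"
        unfolding pk_V_def using * j by (intro member_le_sum) auto
      with j show "pk_V N Ue \<omega> > u" by simp
    qed
  qed
qed

text \<open>A closed form written as total minus remainder, proved by telescoping. For m = n - 1 the
  remainder is the factor of the asymptotic variance that depends on n.\<close>

lemma sum_geometric_moment:
  "(\<Sum>k<m. (1 - \<rho>) * \<rho> ^ k * (real k + 2)) = (2 - \<rho>) / (1 - \<rho>) - \<rho> ^ m * ((1 + real (m + 1) * (1 - \<rho>)) / (1 - \<rho>))"
proof (induction m)
  case 0
  then show ?case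
    using \<rho>_less_1 by (simp add: diff_divide_distrib[symmetric])
next
  case (Suc m)
  define x where "x = 1 - \<rho>"
  have \<rho>: "\<rho> = 1 - x" and "x \<noteq> 0"
    using \<rho>_less_1 by (auto simp: x_def)
  then have "(1 - \<rho>) * (real m + 2)
      = (1 + real (m + 1) * x) / x - \<rho> * ((1 + real (Suc m + 1) * x) / x)"
    unfolding \<rho> by (simp add: field_simps)
  then have "\<rho> ^ m * ((1 - \<rho>) * (real m + 2))
      = \<rho> ^ m * ((1 + real (m + 1) * x) / x) - \<rho> ^ Suc m * ((1 + real (Suc m + 1) * x) / x)"
    by (simp add: right_diff_distrib)
  then show ?case
    using Suc by (simp add: x_def mult_ac)
qed

lemma geometric_moment_sums: "(\<lambda>k. (1 - \<rho>) * \<rho> ^ k * (real k + 2)) sums ((2 - \<rho>) / (1 - \<rho>))"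
proof -
  have "(\<lambda>m. (2 - \<rho>) / (1 - \<rho>) - (\<rho> ^ m * ((2 - \<rho>) / (1 - \<rho>)) + real m * \<rho> ^ m))
      \<longlonglongrightarrow> (2 - \<rho>) / (1 - \<rho>) - (0 * ((2 - \<rho>) / (1 - \<rho>)) + 0)"
    using \<rho>_pos \<rho>_less_1 by (intro tendsto_intros LIMSEQ_power_zero powser_times_n_limit_0) auto
  moreover have "(2 - \<rho>) / (1 - \<rho>) - (\<rho> ^ m * ((2 - \<rho>) / (1 - \<rho>)) + real m * \<rho> ^ m)
      = (\<Sum>k<m. (1 - \<rho>) * \<rho> ^ k * (real k + 2))" for m
    unfolding sum_geometric_moment using \<rho>_less_1 by (simp add: field_simps)
  ultimately show ?thesis
    by (simp add: sums_def)
qed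

lemma pk_V_tail_ratio:
  "((\<lambda>u. prob {\<omega> \<in> space R. pk_V N Ue \<omega> > u} / tail D u) \<longlongrightarrow> (2 - \<rho>) / (1 - \<rho>)) at_top"
proof -
  \<comment> \<open>Kesten's factor 1 + \<delta> has to be beaten by the geometric weights: this
    \<delta> makes \<rho> (1 + \<delta>) the midpoint of \<rho> and 1.\<close>
  define \<delta> where "\<delta> = (1 - \<rho>) / (2 * \<rho>)"
  have "\<delta> > 0"
    using \<rho>_pos \<rho>_less_1 by (simp add: \<delta>_def)
  have \<delta>: "\<rho> * (1 + \<delta>) = (1 + \<rho>) / 2"
    using \<rho>_pos by (simp add: \<delta>_def field_simps)
  obtain K where K: "\<And>n u. tail (conv_iter D n) u \<le> K * (1 + \<delta>) ^ n * tail D u"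
    using E.kesten_bound[OF \<open>\<delta> > 0\<close>] by metis
  define a where "a k u = (1 - \<rho>) * \<rho> ^ k * (tail (conv_iter D (Suc k)) u / tail D u)" for k u
  define B where "B k = ((1 - \<rho>) * K * (1 + \<delta>)) * ((1 + \<rho>) / 2) ^ k" for k
  have bound: "norm (a k u) \<le> B k" for k u
  proof -
    interpret C: half_line_distribution "conv_iter D (Suc k)"
      by (rule E.half_line_distribution_conv_iter)
    have "tail (conv_iter D (Suc k)) u / tail D u \<le> K * (1 + \<delta>) ^ Suc k"
      using K[of "Suc k" u] E.tail_pos[of u] by (simp add: pos_divide_le_eq)
    then have "a k u \<le> (1 - \<rho>) * \<rho> ^ k * (K * (1 + \<delta>) ^ Suc k)"
      unfolding a_def using \<rho>_pos \<rho>_less_1 by (intro mult_left_mono) auto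
    also have "\<dots> = ((1 - \<rho>) * K * (1 + \<delta>)) * (\<rho> * (1 + \<delta>)) ^ k"
      by (simp add: power_mult_distrib)
    also have "\<dots> = B k"
      by (simp add: B_def \<delta>)
    finally show ?thesis
      using C.tail_nonneg[of u] E.tail_nonneg[of u] \<rho>_pos \<rho>_less_1 by (simp add: a_def abs_mult)
  qed
  have "((\<lambda>u. \<Sum>k. a k u) \<longlongrightarrow> (\<Sum>k. (1 - \<rho>) * \<rho> ^ k * (real k + 2))) at_top"
  proof (rule tannerys_theorem[THEN conjunct2, THEN conjunct2])
    show "((\<lambda>u. a k u) \<longlongrightarrow> (1 - \<rho>) * \<rho> ^ k * (real k + 2)) at_top" for k
      unfolding a_def using E.conv_iter_tail_ratio[of "Suc k"]
      by (intro tendsto_mult tendsto_const) (simp add: add_ac)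
    show "eventually (\<lambda>(k, u). norm (a k u) \<le> B k) (at_top \<times>\<^sub>F at_top)"
      using bound by (intro always_eventually) auto
    show "summable B"
      unfolding B_def using \<rho>_pos \<rho>_less_1 by (intro summable_mult summable_geometric) auto
  qed simp
  also have "(\<Sum>k. (1 - \<rho>) * \<rho> ^ k * (real k + 2)) = (2 - \<rho>) / (1 - \<rho>)"
    using geometric_moment_sums by (rule sums_unique[symmetric])
  also have "(\<lambda>u. \<Sum>k. a k u) = (\<lambda>u. prob {\<omega> \<in> space R. pk_V N Ue \<omega> > u} / tail D u)"
  proof
    fix u
    show "(\<Sum>k. a k u) = prob {\<omega> \<in> space R. pk_V N Ue \<omega> > u} / tail D u"
      using sums_divide[OF prob_pk_V[of u], of "tail D u"]
      by (simp add: a_def sums_iff)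
  qed
  finally show ?thesis .
qed

text \<open>Here the sum over k is finite, and with t the tail of one variable (1 - (1 - t)^m) / t
  is the polynomial sum of (1 - t)^i for i < m. It tends to m as t tends to 0.\<close>

lemma pk_Vn_tail_ratio:
  "((\<lambda>u. prob {\<omega> \<in> space R. pk_Vn N Ue n \<omega> > u} / tail D u)
    \<longlongrightarrow> (\<Sum>k<n - 1. (1 - \<rho>) * \<rho> ^ k * (real k + 2))) at_top"
proof -
  have "((\<lambda>u. \<Sum>k<n - 1. (1 - \<rho>) * \<rho> ^ k * (\<Sum>i<k + 2. (1 - tail D u) ^ i))
      \<longlongrightarrow> (\<Sum>k<n - 1. (1 - \<rho>) * \<rho> ^ k * (\<Sum>i<k + 2. (1 - 0) ^ i))) at_top"
    by (intro tendsto_intros E.tail_tendsto_0)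
  moreover have "(\<Sum>k<n - 1. (1 - \<rho>) * \<rho> ^ k * (\<Sum>i<k + 2. (1 - 0) ^ i))
      = (\<Sum>k<n - 1. (1 - \<rho>) * \<rho> ^ k * (real k + 2))"
    by (simp add: add_ac)
  moreover have "eventually (\<lambda>u. (\<Sum>k<n - 1. (1 - \<rho>) * \<rho> ^ k * (\<Sum>i<k + 2. (1 - tail D u) ^ i))
      = prob {\<omega> \<in> space R. pk_Vn N Ue n \<omega> > u} / tail D u) at_top"
    using eventually_ge_at_top[of 0]
  proof eventually_elim
    fix u :: real assume "0 \<le> u"
    have *: "(\<Sum>i<m. (1 - tail D u) ^ i) = (1 - (1 - tail D u) ^ m) / tail D u" for m
      using one_diff_power_eq[of "1 - tail D u" m] E.tail_pos[of u] by simp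
    show "(\<Sum>k<n - 1. (1 - \<rho>) * \<rho> ^ k * (\<Sum>i<k + 2. (1 - tail D u) ^ i))
        = prob {\<omega> \<in> space R. pk_Vn N Ue n \<omega> > u} / tail D u"
      unfolding prob_pk_Vn[OF \<open>0 \<le> u\<close>] * sum_divide_distrib times_divide_eq_right ..
  qed
  ultimately show ?thesis
    using Lim_transform_eventually by fastforce
qed

lemma pk_difference_tail_ratio:
  assumes "1 \<le> n"
  shows "((\<lambda>u. (prob {\<omega> \<in> space R. pk_V N Ue \<omega> > u} - prob {\<omega> \<in> space R. pk_Vn N Ue n \<omega> > u})
      / tail D u) \<longlongrightarrow> \<rho> ^ (n - 1) * ((1 + real n * (1 - \<rho>)) / (1 - \<rho>))) at_top"
  using tendsto_diff[OF pk_V_tail_ratio pk_Vn_tail_ratio[of n]] assms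
  unfolding sum_geometric_moment by (simp add: diff_divide_distrib)

end

subsection \<open>The control variate estimator\<close>

lemma sample_mean_cong: "(\<And>i. i < \<kappa> \<Longrightarrow> z i = z' i) \<Longrightarrow> sample_mean \<kappa> z = sample_mean \<kappa> z'"
  by (simp add: sample_mean_def cong: sum.cong_simp)

lemma sample_mean_0 [simp]: "sample_mean \<kappa> (\<lambda>_. 0) = 0"
  by (simp add: sample_mean_def)

lemma cv_coeff_cong:
  assumes "\<And>i. i < \<kappa> \<Longrightarrow> z i = z' i" "\<And>i. i < \<kappa> \<Longrightarrow> w i = w' i"
  shows "cv_coeff \<kappa> z w = cv_coeff \<kappa> z' w'"
proof -
  have "sample_mean \<kappa> z = sample_mean \<kappa> z'" "sample_mean \<kappa> w = sample_mean \<kappa> w'"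
    using assms by (auto intro: sample_mean_cong)
  moreover from this
  have "(\<Sum>i<\<kappa>. (w i - sample_mean \<kappa> w)\<^sup>2) = (\<Sum>i<\<kappa>. (w' i - sample_mean \<kappa> w')\<^sup>2)"
    "(\<Sum>i<\<kappa>. (z i - sample_mean \<kappa> z) * (w i - sample_mean \<kappa> w))
      = (\<Sum>i<\<kappa>. (z' i - sample_mean \<kappa> z') * (w' i - sample_mean \<kappa> w'))"
    using assms by (auto intro!: sum.cong)
  ultimately show ?thesis
    by (simp add: cv_coeff_def Let_def)
qed

lemma cv_coeff_0 [simp]: "cv_coeff \<kappa> z (\<lambda>_. 0) = 0"
  by (simp add: cv_coeff_def)

text \<open>Only finitely many samples of a two-valued variable exist.\<close>

lemma cv_coeff_bounded:
  obtains K where "0 \<le> K"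
    "\<And>z w. (\<And>i. i < \<kappa> \<Longrightarrow> z i \<in> {0, a} \<and> w i \<in> {0, a}) \<Longrightarrow> \<bar>cv_coeff \<kappa> z w\<bar> \<le> K"
proof -
  define X where "X = PiE {..<\<kappa>} (\<lambda>_. {0, a})"
  define Y where "Y = (\<lambda>(z, w). \<bar>cv_coeff \<kappa> z w\<bar>) ` (X \<times> X)"
  have "finite Y"
    unfolding Y_def X_def by (intro finite_imageI finite_cartesian_product finite_PiE) auto
  have le: "\<bar>cv_coeff \<kappa> z w\<bar> \<le> Max (insert 0 Y)"
    if "\<And>i. i < \<kappa> \<Longrightarrow> z i \<in> {0, a} \<and> w i \<in> {0, a}" for z w
  proof (rule Max_ge)
    have "cv_coeff \<kappa> z w = cv_coeff \<kappa> (restrict z {..<\<kappa>}) (restrict w {..<\<kappa>})"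
      by (rule cv_coeff_cong) auto
    moreover have "restrict z {..<\<kappa>} \<in> X" "restrict w {..<\<kappa>} \<in> X"
      using that by (auto simp: X_def)
    ultimately show "\<bar>cv_coeff \<kappa> z w\<bar> \<in> insert 0 Y"
      unfolding Y_def by force
  qed (use \<open>finite Y\<close> in simp)
  show ?thesis
    by (rule that[OF _ le]) (use \<open>finite Y\<close> in auto)
qed

lemma sample_mean_two_valued:
  assumes "0 < a" "0 < \<kappa>" "\<And>i. i < \<kappa> \<Longrightarrow> z i \<in> {0, a}"
  shows "\<bar>sample_mean \<kappa> z\<bar> \<le> a"
proof -
  have "0 \<le> (\<Sum>i<\<kappa>. z i)"
    using assms by (intro sum_nonneg) force
  moreover have "(\<Sum>i<\<kappa>. z i) \<le> (\<Sum>i<\<kappa>. a)"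
    using assms by (intro sum_mono) force
  ultimately show ?thesis
    using assms by (simp add: sample_mean_def field_simps)
qed

lemma sum_single_nonzero:
  fixes f :: "nat \<Rightarrow> 'a :: comm_monoid_add"
  assumes "k < \<kappa>" "\<And>i. i < \<kappa> \<Longrightarrow> i \<noteq> k \<Longrightarrow> f i = 0"
  shows "(\<Sum>i<\<kappa>. f i) = f k"
  using assms by (subst sum.mono_neutral_right[of _ "{k}"]) auto

text \<open>For equal samples the numerator is the denominator; two different sample values keep the
  latter from vanishing, so the default 0 does not interfere.\<close>

lemma cv_coeff_self:
  assumes "\<And>i. i < \<kappa> \<Longrightarrow> z i = w i" "i < \<kappa>" "j < \<kappa>" "w i \<noteq> w j"
  shows "cv_coeff \<kappa> z w = -1"
proof -
  have "cv_coeff \<kappa> z w = cv_coeff \<kappa> w w"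
    using assms(1) by (rule cv_coeff_cong) auto
  moreover have "(\<Sum>i<\<kappa>. (w i - sample_mean \<kappa> w)\<^sup>2) \<noteq> 0"
    using assms(2-4) by (subst sum_nonneg_eq_0_iff) (auto, metis lessThan_iff)
  ultimately show ?thesis
    by (simp add: cv_coeff_def power2_eq_square)
qed

text \<open>The main term counts indices with z nonzero and w zero. If no z is nonzero, the
  estimator and both sides of the last two bounds vanish. With exactly one, the error of the square
  is 0 or \<open>\<phi>\<^sup>2\<close>. With two or more, the sum over pairs is at least 1 and pays
  for the crude bounds \<open>L\<^sup>2\<close> of the square and
  \<open>a\<^sup>2 / real \<kappa>\<close> of the main term. \<open>L\<close> stems from sample
  means in [0, a] and a coefficient of size at most K.\<close>

lemma cv_estimator_expansion:
  fixes z w :: "nat \<Rightarrow> real"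
  defines "s \<equiv> \<lambda>i. of_bool (z i \<noteq> 0) :: real"
  assumes a: "0 < a" and \<kappa>: "2 \<le> \<kappa>" and \<phi>: "0 \<le> \<phi>" "\<phi> \<le> a" and K: "0 \<le> K" "\<bar>cv_coeff \<kappa> z w\<bar> \<le> K"
    and zw: "\<And>i. i < \<kappa> \<Longrightarrow> z i \<in> {0, a} \<and> w i \<in> {0, a} \<and> (w i \<noteq> 0 \<longrightarrow> z i \<noteq> 0)"
    and L: "L = a + K * (2 * a)"
  shows "\<bar>cv_estimator \<kappa> \<phi> z w\<bar> \<le> L" (is ?bdd)
    and "\<bar>cv_estimator \<kappa> \<phi> z w\<bar> \<le> L * (\<Sum>i<\<kappa>. s i)" (is ?first)
    and "\<bar>(cv_estimator \<kappa> \<phi> z w)\<^sup>2 - a\<^sup>2 / (real \<kappa>)\<^sup>2 * (\<Sum>i<\<kappa>. of_bool (z i \<noteq> 0) - of_bool (w i \<noteq> 0))\<bar>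
      \<le> \<phi>\<^sup>2 * (\<Sum>i<\<kappa>. s i) + (L\<^sup>2 + a\<^sup>2 / real \<kappa>) * (\<Sum>i<\<kappa>. \<Sum>j\<in>{..<\<kappa>} - {i}. s i * s j)"
      (is ?second)
proof -
  define est where "est = cv_estimator \<kappa> \<phi> z w"
  define t where "t i = (of_bool (z i \<noteq> 0) - of_bool (w i \<noteq> 0) :: real)" for i
  have s: "0 \<le> s i" "s i \<le> 1" for i
    by (auto simp: s_def)
  have t: "0 \<le> t i" "t i \<le> 1" if "i < \<kappa>" for i
    using zw[OF that] by (auto simp: t_def)
  have "L \<ge> 0"
    using a K by (simp add: L)
  have "\<bar>est\<bar> \<le> \<bar>sample_mean \<kappa> z\<bar> + \<bar>cv_coeff \<kappa> z w\<bar> * (\<bar>sample_mean \<kappa> w\<bar> + \<bar>\<phi>\<bar>)"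
    unfolding est_def cv_estimator_def
    by (rule order_trans[OF abs_triangle_ineq add_left_mono])
      (simp add: abs_mult mult_left_mono abs_triangle_ineq4)
  also have "\<dots> \<le> a + K * (a + a)"
    using a \<kappa> K \<phi> zw by (intro add_mono mult_mono sample_mean_two_valued) auto
  finally have bdd: "\<bar>est\<bar> \<le> L"
    by (simp add: L)
  have sum_s: "0 \<le> (\<Sum>i<\<kappa>. s i)"
    using s by (intro sum_nonneg)
  have sum_ss: "0 \<le> (\<Sum>i<\<kappa>. \<Sum>j\<in>{..<\<kappa>} - {i}. s i * s j)"
    using s by (intro sum_nonneg mult_nonneg_nonneg)
  have "\<bar>est\<bar> \<le> L * (\<Sum>i<\<kappa>. s i) \<and> \<bar>est\<^sup>2 - a\<^sup>2 / (real \<kappa>)\<^sup>2 * (\<Sum>i<\<kappa>. t i)\<bar>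
      \<le> \<phi>\<^sup>2 * (\<Sum>i<\<kappa>. s i) + (L\<^sup>2 + a\<^sup>2 / real \<kappa>) * (\<Sum>i<\<kappa>. \<Sum>j\<in>{..<\<kappa>} - {i}. s i * s j)"
  proof (cases "\<exists>k<\<kappa>. z k \<noteq> 0")
    case False
    then have z0: "\<And>i. i < \<kappa> \<Longrightarrow> z i = 0" and w0: "\<And>i. i < \<kappa> \<Longrightarrow> w i = 0"
      using zw by auto
    have "est = 0"
      unfolding est_def cv_estimator_def using sample_mean_cong[of \<kappa> z "\<lambda>_. 0"] z0
        cv_coeff_cong[of \<kappa> z z w "\<lambda>_. 0"] w0 by simp
    moreover have "(\<Sum>i<\<kappa>. t i) = 0"
      using z0 w0 by (intro sum.neutral) (auto simp: t_def)
    ultimately show ?thesis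
      using sum_s sum_ss \<open>L \<ge> 0\<close> by simp
  next
    case True
    then obtain k where k: "k < \<kappa>" "z k \<noteq> 0"
      by auto
    have "s k \<le> (\<Sum>i<\<kappa>. s i)"
      using k s by (intro member_le_sum) auto
    then have s1: "1 \<le> (\<Sum>i<\<kappa>. s i)"
      using k by (simp add: s_def)
    have "\<bar>est\<bar> \<le> L * (\<Sum>i<\<kappa>. s i)"
      using bdd mult_left_mono[OF s1 \<open>L \<ge> 0\<close>] by simp
    moreover have "\<bar>est\<^sup>2 - a\<^sup>2 / (real \<kappa>)\<^sup>2 * (\<Sum>i<\<kappa>. t i)\<bar>
      \<le> \<phi>\<^sup>2 * (\<Sum>i<\<kappa>. s i) + (L\<^sup>2 + a\<^sup>2 / real \<kappa>) * (\<Sum>i<\<kappa>. \<Sum>j\<in>{..<\<kappa>} - {i}. s i * s j)"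
    proof (cases "\<exists>j<\<kappa>. j \<noteq> k \<and> z j \<noteq> 0")
      case True
      then obtain j where j: "j < \<kappa>" "j \<noteq> k" "z j \<noteq> 0"
        by auto
      have "s k * s j \<le> (\<Sum>j\<in>{..<\<kappa>} - {k}. s k * s j)"
        using j s by (intro member_le_sum[where f = "\<lambda>j. s k * s j"]) auto
      also have "\<dots> \<le> (\<Sum>i<\<kappa>. \<Sum>j\<in>{..<\<kappa>} - {i}. s i * s j)"
        using k s by (intro member_le_sum[where f = "\<lambda>i. \<Sum>j\<in>{..<\<kappa>} - {i}. s i * s j"] sum_nonneg) auto
      finally have ss1: "1 \<le> (\<Sum>i<\<kappa>. \<Sum>j\<in>{..<\<kappa>} - {i}. s i * s j)"
        using j k by (simp add: s_def)
      have "0 \<le> (\<Sum>i<\<kappa>. t i)"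
        using t by (intro sum_nonneg) auto
      moreover have "(\<Sum>i<\<kappa>. t i) \<le> (\<Sum>i<\<kappa>. 1)"
        using t by (intro sum_mono) auto
      ultimately have "0 \<le> a\<^sup>2 / (real \<kappa>)\<^sup>2 * (\<Sum>i<\<kappa>. t i)"
        "a\<^sup>2 / (real \<kappa>)\<^sup>2 * (\<Sum>i<\<kappa>. t i) \<le> a\<^sup>2 / (real \<kappa>)\<^sup>2 * real \<kappa>"
        by (intro mult_nonneg_nonneg mult_left_mono; simp)+
      moreover have "a\<^sup>2 / (real \<kappa>)\<^sup>2 * real \<kappa> = a\<^sup>2 / real \<kappa>"
        using \<kappa> by (simp add: power2_eq_square)
      moreover have "0 \<le> est\<^sup>2" "est\<^sup>2 \<le> L\<^sup>2"
        using bdd power_mono[OF bdd, of 2] by auto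
      ultimately have "\<bar>est\<^sup>2 - a\<^sup>2 / (real \<kappa>)\<^sup>2 * (\<Sum>i<\<kappa>. t i)\<bar> \<le> (L\<^sup>2 + a\<^sup>2 / real \<kappa>) * 1"
        by (smt (verit) zero_le_power2)
      also have "\<dots> \<le> (L\<^sup>2 + a\<^sup>2 / real \<kappa>) * (\<Sum>i<\<kappa>. \<Sum>j\<in>{..<\<kappa>} - {i}. s i * s j)"
        using ss1 by (intro mult_left_mono) auto
      finally show ?thesis
        using sum_s by (smt (verit) mult_nonneg_nonneg zero_le_power2)
    next
      case False
      then have z0: "\<And>i. i < \<kappa> \<Longrightarrow> i \<noteq> k \<Longrightarrow> z i = 0" and w0: "\<And>i. i < \<kappa> \<Longrightarrow> i \<noteq> k \<Longrightarrow> w i = 0"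
        using zw by auto
      have zk: "z k = a"
        using zw[OF k(1)] k(2) by auto
      have sum_t: "(\<Sum>i<\<kappa>. t i) = t k"
        using k z0 w0 by (intro sum_single_nonzero) (auto simp: t_def)
      have "est\<^sup>2 - a\<^sup>2 / (real \<kappa>)\<^sup>2 * (\<Sum>i<\<kappa>. t i) \<in> {0, \<phi>\<^sup>2}"
      proof (cases "w k = 0")
        case True
        then have "\<And>i. i < \<kappa> \<Longrightarrow> w i = 0"
          using w0 by metis
        then have "est = sample_mean \<kappa> z"
          unfolding est_def cv_estimator_def using cv_coeff_cong[of \<kappa> z z w "\<lambda>_. 0"] by simp
        also have "\<dots> = a / real \<kappa>"
          using sum_single_nonzero[of k \<kappa> z] k z0 zk by (simp add: sample_mean_def)
        finally show ?thesis
          using True k unfolding sum_t by (simp add: t_def power_divide)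
      next
        case False
        have eq: "z i = w i" if "i < \<kappa>" for i
          using zw[OF that] zw[OF k(1)] False z0[OF that] w0[OF that] by (cases "i = k") auto
        \<comment> \<open>A second index, where w vanishes; it exists because \<kappa> is at least 2
          and shows that the sample of w is not constant.\<close>
        define l where "l = (if k = 0 then 1 else 0 :: nat)"
        have "l < \<kappa>" "l \<noteq> k"
          using \<kappa> by (auto simp: l_def)
        then have "cv_coeff \<kappa> z w = -1"
          using eq k w0 False by (intro cv_coeff_self[of \<kappa> z w k l]) auto
        then have "est = \<phi>"
          unfolding est_def cv_estimator_def using sample_mean_cong[of \<kappa> z w] eq by simp
        then show ?thesis
          using False k unfolding sum_t by (simp add: t_def)
      qed
      then have "\<bar>est\<^sup>2 - a\<^sup>2 / (real \<kappa>)\<^sup>2 * (\<Sum>i<\<kappa>. t i)\<bar> \<le> \<phi>\<^sup>2 * 1"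
        by auto
      also have "\<dots> \<le> \<phi>\<^sup>2 * (\<Sum>i<\<kappa>. s i)"
        using s1 by (intro mult_left_mono) auto
      finally show ?thesis
        using sum_ss by (smt (verit) mult_nonneg_nonneg zero_le_power2 divide_nonneg_nonneg of_nat_0_le_iff)
    qed
    ultimately show ?thesis by simp
  qed
  with bdd show ?bdd ?first ?second
    by (simp_all add: est_def t_def)
qed

text \<open>\<open>C\<close> is obtained before the variables and probabilities: depending only on a
  and \<kappa>, it is uniform in u and also covers a vanishing control variate. Independence enters
  solely through the probability \<open>p\<^sup>2\<close> of two nonzero z.\<close>

lemma (in prob_space) cv_estimator_variance:
  assumes a: "0 < a" and \<kappa>: "2 \<le> \<kappa>"
  obtains C where "\<And>z w p q. (\<And>i. i < \<kappa> \<Longrightarrow> random_variable borel (z i)) \<Longrightarrow>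
      (\<And>i. i < \<kappa> \<Longrightarrow> random_variable borel (w i)) \<Longrightarrow>
      (\<And>i. i < \<kappa> \<Longrightarrow>
        AE \<omega> in M. z i \<omega> \<in> {0, a} \<and> w i \<omega> \<in> {0, a} \<and> (w i \<omega> \<noteq> 0 \<longrightarrow> z i \<omega> \<noteq> 0)) \<Longrightarrow>
      (\<And>i. i < \<kappa> \<Longrightarrow> prob {\<omega> \<in> space M. z i \<omega> \<noteq> 0} = p) \<Longrightarrow>
      (\<And>i. i < \<kappa> \<Longrightarrow> prob {\<omega> \<in> space M. w i \<omega> \<noteq> 0} = q) \<Longrightarrow>
      (\<And>i j. i < \<kappa> \<Longrightarrow> j < \<kappa> \<Longrightarrow> i \<noteq> j \<Longrightarrow>
        prob {\<omega> \<in> space M. z i \<omega> \<noteq> 0 \<and> z j \<omega> \<noteq> 0} = p\<^sup>2) \<Longrightarrow>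
      \<bar>variance (\<lambda>\<omega>. cv_estimator \<kappa> (a * q) (\<lambda>i. z i \<omega>) (\<lambda>i. w i \<omega>))
        - a\<^sup>2 / real \<kappa> * (p - q)\<bar> \<le> C * p\<^sup>2"
proof -
  obtain K where K: "0 \<le> K"
    "\<And>z w. (\<And>i. i < \<kappa> \<Longrightarrow> z i \<in> {0, a} \<and> w i \<in> {0, a}) \<Longrightarrow> \<bar>cv_coeff \<kappa> z w\<bar> \<le> K"
    using cv_coeff_bounded[of \<kappa> a] by metis
  define L where "L = a + K * (2 * a)"
  define c where "c = L\<^sup>2 + a\<^sup>2 / real \<kappa>"
  \<comment> \<open>The three terms bound the single samples hit by the control variate, the ordered
    pairs of nonzero samples, and the squared mean.\<close>
  define C where "C = (a\<^sup>2 * real \<kappa> + c * (real \<kappa> * real (\<kappa> - 1))) + (L * real \<kappa>)\<^sup>2"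
  show ?thesis
  proof (rule that[of C])
    fix z w :: "nat \<Rightarrow> 'a \<Rightarrow> real" and p q :: real
    assume z: "\<And>i. i < \<kappa> \<Longrightarrow> random_variable borel (z i)"
      and w: "\<And>i. i < \<kappa> \<Longrightarrow> random_variable borel (w i)"
      and AE: "\<And>i. i < \<kappa> \<Longrightarrow>
        AE \<omega> in M. z i \<omega> \<in> {0, a} \<and> w i \<omega> \<in> {0, a} \<and> (w i \<omega> \<noteq> 0 \<longrightarrow> z i \<omega> \<noteq> 0)"
      and p: "\<And>i. i < \<kappa> \<Longrightarrow> prob {\<omega> \<in> space M. z i \<omega> \<noteq> 0} = p"
      and q: "\<And>i. i < \<kappa> \<Longrightarrow> prob {\<omega> \<in> space M. w i \<omega> \<noteq> 0} = q"
      and pp: "\<And>i j. i < \<kappa> \<Longrightarrow> j < \<kappa> \<Longrightarrow> i \<noteq> j \<Longrightarrow>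
        prob {\<omega> \<in> space M. z i \<omega> \<noteq> 0 \<and> z j \<omega> \<noteq> 0} = p\<^sup>2"
    define X where "X = (\<lambda>\<omega>. cv_estimator \<kappa> (a * q) (\<lambda>i. z i \<omega>) (\<lambda>i. w i \<omega>))"
    define s where "s i \<omega> = (of_bool (z i \<omega> \<noteq> 0) :: real)" for i \<omega>
    define s' where "s' i \<omega> = (of_bool (w i \<omega> \<noteq> 0) :: real)" for i \<omega>
    have event: "{\<omega> \<in> space M. z i \<omega> \<noteq> 0} \<in> events" "{\<omega> \<in> space M. w i \<omega> \<noteq> 0} \<in> events" if "i < \<kappa>" for i
      using z[OF that] w[OF that] by measurable
    have q_le_p: "q \<le> p"
    proof -
      have "prob {\<omega> \<in> space M. w 0 \<omega> \<noteq> 0} \<le> prob {\<omega> \<in> space M. z 0 \<omega> \<noteq> 0}"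
        using AE[of 0] event[of 0] \<kappa> by (intro finite_measure_mono_AE) auto
      then show ?thesis
        using p[of 0] q[of 0] \<kappa> by simp
    qed
    have pq: "0 \<le> q" "0 \<le> p" "p \<le> 1" "q \<le> 1"
      using p[of 0] q[of 0] \<kappa> by (auto simp flip: p q)
    have AE_all: "AE \<omega> in M. \<forall>i\<in>{..<\<kappa>}. z i \<omega> \<in> {0, a} \<and> w i \<omega> \<in> {0, a} \<and> (w i \<omega> \<noteq> 0 \<longrightarrow> z i \<omega> \<noteq> 0)"
      using AE by (intro AE_finite_allI) auto
    have [measurable]: "X \<in> borel_measurable M"
    proof -
      have m: "(\<lambda>\<omega>. sample_mean \<kappa> (\<lambda>i. z i \<omega>)) \<in> borel_measurable M"
        "(\<lambda>\<omega>. sample_mean \<kappa> (\<lambda>i. w i \<omega>)) \<in> borel_measurable M"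
        unfolding sample_mean_def
        by (intro borel_measurable_times borel_measurable_const borel_measurable_sum z w; simp)+
      have d: "(\<lambda>\<omega>. \<Sum>i<\<kappa>. (w i \<omega> - sample_mean \<kappa> (\<lambda>i. w i \<omega>))\<^sup>2) \<in> borel_measurable M"
        "(\<lambda>\<omega>. \<Sum>i<\<kappa>. (z i \<omega> - sample_mean \<kappa> (\<lambda>i. z i \<omega>)) * (w i \<omega> - sample_mean \<kappa> (\<lambda>i. w i \<omega>)))
          \<in> borel_measurable M"
        by (intro borel_measurable_sum borel_measurable_power borel_measurable_times borel_measurable_diff m z w; simp)+
      show ?thesis
        unfolding X_def cv_estimator_def cv_coeff_def Let_def
        by (intro borel_measurable_add borel_measurable_times borel_measurable_diff borel_measurable_const m
            measurable_If borel_measurable_uminus borel_measurable_divide d borel_measurable_eq)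
    qed
    have expansion: "AE \<omega> in M. \<bar>X \<omega>\<bar> \<le> L \<and> \<bar>X \<omega>\<bar> \<le> L * (\<Sum>i<\<kappa>. s i \<omega>)
        \<and> \<bar>(X \<omega>)\<^sup>2 - a\<^sup>2 / (real \<kappa>)\<^sup>2 * (\<Sum>i<\<kappa>. s i \<omega> - s' i \<omega>)\<bar>
          \<le> (a * q)\<^sup>2 * (\<Sum>i<\<kappa>. s i \<omega>) + c * (\<Sum>i<\<kappa>. \<Sum>j\<in>{..<\<kappa>} - {i}. s i \<omega> * s j \<omega>)"
      using AE_all
    proof eventually_elim
      fix \<omega> assume "\<forall>i\<in>{..<\<kappa>}. z i \<omega> \<in> {0, a} \<and> w i \<omega> \<in> {0, a} \<and> (w i \<omega> \<noteq> 0 \<longrightarrow> z i \<omega> \<noteq> 0)"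
      then have *: "\<And>i. i < \<kappa> \<Longrightarrow> z i \<omega> \<in> {0, a} \<and> w i \<omega> \<in> {0, a} \<and> (w i \<omega> \<noteq> 0 \<longrightarrow> z i \<omega> \<noteq> 0)"
        by blast
      then have K': "\<bar>cv_coeff \<kappa> (\<lambda>i. z i \<omega>) (\<lambda>i. w i \<omega>)\<bar> \<le> K"
        by (intro K(2)) blast
      have \<phi>: "0 \<le> a * q" "a * q \<le> a"
        using a pq by (auto simp: mult_left_le)
      show "\<bar>X \<omega>\<bar> \<le> L \<and> \<bar>X \<omega>\<bar> \<le> L * (\<Sum>i<\<kappa>. s i \<omega>)
        \<and> \<bar>(X \<omega>)\<^sup>2 - a\<^sup>2 / (real \<kappa>)\<^sup>2 * (\<Sum>i<\<kappa>. s i \<omega> - s' i \<omega>)\<bar>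
          \<le> (a * q)\<^sup>2 * (\<Sum>i<\<kappa>. s i \<omega>) + c * (\<Sum>i<\<kappa>. \<Sum>j\<in>{..<\<kappa>} - {i}. s i \<omega> * s j \<omega>)"
        unfolding X_def s_def s'_def c_def
        using cv_estimator_expansion[OF a \<kappa> \<phi> K(1) K' * L_def] by blast
    qed
    have int_X: "integrable M X" "integrable M (\<lambda>\<omega>. (X \<omega>)\<^sup>2)"
    proof -
      show "integrable M X"
        by (rule integrable_const_bound[where B = L]) (use expansion in auto)
      have "AE \<omega> in M. norm ((X \<omega>)\<^sup>2) \<le> L\<^sup>2"
        using expansion by eventually_elim (metis abs_ge_zero power2_abs power_mono real_norm_def abs_power2)
      then show "integrable M (\<lambda>\<omega>. (X \<omega>)\<^sup>2)"
        by (rule integrable_const_bound) simp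
    qed
    have s_ind: "integrable M (s i) \<and> expectation (s i) = p" "integrable M (s' i) \<and> expectation (s' i) = q"
      if "i < \<kappa>" for i
    proof -
      have "s i \<omega> = indicator {\<omega> \<in> space M. z i \<omega> \<noteq> 0} \<omega>"
        "s' i \<omega> = indicator {\<omega> \<in> space M. w i \<omega> \<noteq> 0} \<omega>" if "\<omega> \<in> space M" for \<omega>
        using that by (auto simp: s_def s'_def)
      note cong = Bochner_Integration.integrable_cong[OF refl this(1)]
        Bochner_Integration.integral_cong[OF refl this(1)]
        Bochner_Integration.integrable_cong[OF refl this(2)]
        Bochner_Integration.integral_cong[OF refl this(2)]
      show "integrable M (s i) \<and> expectation (s i) = p" "integrable M (s' i) \<and> expectation (s' i) = q"
        using event[OF that, THEN sets.Int_space_eq2] event[OF that] p[OF that] q[OF that]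
        by (auto simp: cong less_top[symmetric])
    qed
    have ss_ind: "integrable M (\<lambda>\<omega>. s i \<omega> * s j \<omega>) \<and> expectation (\<lambda>\<omega>. s i \<omega> * s j \<omega>) = p\<^sup>2"
      if "i < \<kappa>" "j < \<kappa>" "i \<noteq> j" for i j
    proof -
      have "{\<omega> \<in> space M. z i \<omega> \<noteq> 0 \<and> z j \<omega> \<noteq> 0} \<in> events"
        using z[OF that(1)] z[OF that(2)] by measurable
      note event = this
      have "s i \<omega> * s j \<omega> = indicator {\<omega> \<in> space M. z i \<omega> \<noteq> 0 \<and> z j \<omega> \<noteq> 0} \<omega>"
        if "\<omega> \<in> space M" for \<omega>
        using that by (auto simp: s_def)
      note cong = Bochner_Integration.integrable_cong[OF refl this]
        Bochner_Integration.integral_cong[OF refl this]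
      show ?thesis
        using event[THEN sets.Int_space_eq2] event pp[OF that]
        by (auto simp: cong less_top[symmetric])
    qed
    have int_s: "integrable M (\<lambda>\<omega>. \<Sum>i<\<kappa>. s i \<omega>)" "integrable M (\<lambda>\<omega>. \<Sum>i<\<kappa>. s i \<omega> - s' i \<omega>)"
      "integrable M (\<lambda>\<omega>. \<Sum>i<\<kappa>. \<Sum>j\<in>{..<\<kappa>} - {i}. s i \<omega> * s j \<omega>)"
      using s_ind ss_ind
      by (auto intro!: Bochner_Integration.integrable_sum Bochner_Integration.integrable_diff)
    have ex_s: "expectation (\<lambda>\<omega>. \<Sum>i<\<kappa>. s i \<omega>) = real \<kappa> * p"
      using s_ind by (subst Bochner_Integration.integral_sum) auto
    have ex_diff: "expectation (\<lambda>\<omega>. \<Sum>i<\<kappa>. s i \<omega> - s' i \<omega>) = real \<kappa> * (p - q)"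
      using s_ind by (subst Bochner_Integration.integral_sum) auto
    have "expectation (\<lambda>\<omega>. \<Sum>j\<in>{..<\<kappa>} - {i}. s i \<omega> * s j \<omega>) = real (\<kappa> - 1) * p\<^sup>2"
      if "i < \<kappa>" for i
      using ss_ind that by (subst Bochner_Integration.integral_sum) auto
    then have ex_ss: "expectation (\<lambda>\<omega>. \<Sum>i<\<kappa>. \<Sum>j\<in>{..<\<kappa>} - {i}. s i \<omega> * s j \<omega>)
        = real \<kappa> * (real (\<kappa> - 1) * p\<^sup>2)"
      using ss_ind by (subst Bochner_Integration.integral_sum)
        (auto intro!: Bochner_Integration.integrable_sum)
    have "\<bar>expectation (\<lambda>\<omega>. (X \<omega>)\<^sup>2 - a\<^sup>2 / (real \<kappa>)\<^sup>2 * (\<Sum>i<\<kappa>. s i \<omega> - s' i \<omega>))\<bar>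
        \<le> expectation (\<lambda>\<omega>. \<bar>(X \<omega>)\<^sup>2 - a\<^sup>2 / (real \<kappa>)\<^sup>2 * (\<Sum>i<\<kappa>. s i \<omega> - s' i \<omega>)\<bar>)"
      by (rule integral_abs_bound)
    also have "\<dots> \<le> expectation (\<lambda>\<omega>. (a * q)\<^sup>2 * (\<Sum>i<\<kappa>. s i \<omega>) + c * (\<Sum>i<\<kappa>. \<Sum>j\<in>{..<\<kappa>} - {i}. s i \<omega> * s j \<omega>))"
    proof (rule integral_mono_AE)
      show "AE \<omega> in M. \<bar>(X \<omega>)\<^sup>2 - a\<^sup>2 / (real \<kappa>)\<^sup>2 * (\<Sum>i<\<kappa>. s i \<omega> - s' i \<omega>)\<bar>
          \<le> (a * q)\<^sup>2 * (\<Sum>i<\<kappa>. s i \<omega>) + c * (\<Sum>i<\<kappa>. \<Sum>j\<in>{..<\<kappa>} - {i}. s i \<omega> * s j \<omega>)"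
        using expansion by eventually_elim blast
    qed (intro integrable_abs Bochner_Integration.integrable_diff Bochner_Integration.integrable_add
        integrable_mult_right int_X int_s)+
    also have "\<dots> = (a * q)\<^sup>2 * (real \<kappa> * p) + c * (real \<kappa> * (real (\<kappa> - 1) * p\<^sup>2))"
      using int_s by (simp add: ex_s ex_ss)
    also have "\<dots> \<le> (a\<^sup>2 * real \<kappa> + c * (real \<kappa> * real (\<kappa> - 1))) * p\<^sup>2"
    proof -
      \<comment> \<open>Since \<phi> = a q is itself of the order of a probability, its square times
        p is small enough.\<close>
      have "q\<^sup>2 * p \<le> p\<^sup>2 * 1"
        using pq q_le_p by (intro mult_mono power_mono) auto
      then have "a\<^sup>2 * real \<kappa> * (q\<^sup>2 * p) \<le> a\<^sup>2 * real \<kappa> * p\<^sup>2"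
        by (intro mult_left_mono) auto
      then show ?thesis
        by (simp add: algebra_simps power_mult_distrib)
    qed
    also have "expectation (\<lambda>\<omega>. (X \<omega>)\<^sup>2 - a\<^sup>2 / (real \<kappa>)\<^sup>2 * (\<Sum>i<\<kappa>. s i \<omega> - s' i \<omega>))
        = expectation (\<lambda>\<omega>. (X \<omega>)\<^sup>2) - a\<^sup>2 / real \<kappa> * (p - q)"
      using int_X(2) int_s(2) \<kappa>
      by (subst Bochner_Integration.integral_diff) (simp_all add: ex_diff power2_eq_square)
    finally have second: "\<bar>expectation (\<lambda>\<omega>. (X \<omega>)\<^sup>2) - a\<^sup>2 / real \<kappa> * (p - q)\<bar>
        \<le> (a\<^sup>2 * real \<kappa> + c * (real \<kappa> * real (\<kappa> - 1))) * p\<^sup>2" .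
    have "\<bar>expectation X\<bar> \<le> expectation (\<lambda>\<omega>. \<bar>X \<omega>\<bar>)"
      by (rule integral_abs_bound)
    also have "\<dots> \<le> expectation (\<lambda>\<omega>. L * (\<Sum>i<\<kappa>. s i \<omega>))"
    proof (rule integral_mono_AE)
      show "AE \<omega> in M. \<bar>X \<omega>\<bar> \<le> L * (\<Sum>i<\<kappa>. s i \<omega>)"
        using expansion by eventually_elim blast
    qed (intro integrable_abs integrable_mult_right int_X int_s)+
    also have "\<dots> = L * real \<kappa> * p"
      by (simp add: ex_s)
    finally have "\<bar>expectation X\<bar>\<^sup>2 \<le> (L * real \<kappa> * p)\<^sup>2"
      by (rule power_mono) simp
    then have first: "(expectation X)\<^sup>2 \<le> (L * real \<kappa>)\<^sup>2 * p\<^sup>2"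
      by (simp add: power_mult_distrib)
    have "variance X = expectation (\<lambda>\<omega>. (X \<omega>)\<^sup>2) - (expectation X)\<^sup>2"
      using int_X by (rule variance_eq)
    then have "\<bar>variance X - a\<^sup>2 / real \<kappa> * (p - q)\<bar> \<le> C * p\<^sup>2"
      using first second unfolding C_def distrib_right by (smt (verit) zero_le_power2)
    then show "\<bar>variance (\<lambda>\<omega>. cv_estimator \<kappa> (a * q) (\<lambda>i. z i \<omega>) (\<lambda>i. w i \<omega>))
        - a\<^sup>2 / real \<kappa> * (p - q)\<bar> \<le> C * p\<^sup>2"
      by (simp add: X_def)
  qed
qed

subsection \<open>Asymptotic variances\<close>

text \<open>Divided by T, the error is C (p / T)^2 T: a convergent factor times a null
  function.\<close>

lemma tendsto_ratio_perturbed: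
  fixes V d p T :: "real \<Rightarrow> real"
  assumes V: "eventually (\<lambda>u. \<bar>V u - k * d u\<bar> \<le> C * (p u)\<^sup>2) F"
    and d: "((\<lambda>u. d u / T u) \<longlongrightarrow> l) F" and p: "((\<lambda>u. p u / T u) \<longlongrightarrow> r) F"
    and T: "(T \<longlongrightarrow> 0) F" "\<And>u. 0 < T u"
  shows "((\<lambda>u. V u / T u) \<longlongrightarrow> k * l) F"
proof -
  have "((\<lambda>u. C * ((p u / T u)\<^sup>2 * T u)) \<longlongrightarrow> C * (r\<^sup>2 * 0)) F"
    by (intro tendsto_intros p T)
  then have null: "((\<lambda>u. C * ((p u / T u)\<^sup>2 * T u)) \<longlongrightarrow> 0) F"
    by simp
  have "eventually (\<lambda>u. \<bar>V u / T u - k * (d u / T u)\<bar> \<le> C * ((p u / T u)\<^sup>2 * T u)) F"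
    using V
  proof eventually_elim
    fix u assume "\<bar>V u - k * d u\<bar> \<le> C * (p u)\<^sup>2"
    then have "\<bar>V u - k * d u\<bar> / T u \<le> C * (p u)\<^sup>2 / T u"
      using T(2)[of u] by (intro divide_right_mono) auto
    also have "\<bar>V u - k * d u\<bar> / T u = \<bar>V u / T u - k * (d u / T u)\<bar>"
      using T(2)[of u] by (simp add: diff_divide_distrib[symmetric])
    also have "C * (p u)\<^sup>2 / T u = C * ((p u / T u)\<^sup>2 * T u)"
      using T(2)[of u] by (simp add: power2_eq_square)
    finally show "\<bar>V u / T u - k * (d u / T u)\<bar> \<le> C * ((p u / T u)\<^sup>2 * T u)" .
  qed
  then have "((\<lambda>u. V u / T u - k * (d u / T u)) \<longlongrightarrow> 0) F"
    by (intro Lim_null_comparison[OF _ null]) (simp only: real_norm_def)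
  then have "((\<lambda>u. V u / T u - k * (d u / T u) + k * (d u / T u)) \<longlongrightarrow> 0 + k * l) F"
    by (intro tendsto_add tendsto_mult d tendsto_const)
  then show ?thesis
    by simp
qed

section \<open>Transfer to the independent copies and the resulting limits\<close>

context subexponential_pk
begin

lemma measurable_pk_Z [measurable]: "pk_Z \<rho> N Ue u \<in> borel_measurable R"
proof -
  have [measurable]: "Measurable.pred R (\<lambda>\<omega>. pk_V N Ue \<omega> > u)"
    using pk_V_event by (simp add: pred_def)
  show ?thesis
    unfolding pk_Z_def[abs_def] of_bool_def by measurable
qed

lemma measurable_pk_W: "0 \<le> u \<Longrightarrow> pk_W \<rho> N Ue n u \<in> borel_measurable R"
proof -
  assume "0 \<le> u"
  then have [measurable]: "Measurable.pred R (\<lambda>\<omega>. pk_Vn N Ue n \<omega> > u)"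
    using pk_Vn_event by (simp add: pred_def)
  show ?thesis
    unfolding pk_W_def[abs_def] of_bool_def by measurable
qed

lemma integral_pk_W:
  assumes "0 \<le> u"
  shows "expectation (pk_W \<rho> N Ue n u) = \<rho>\<^sup>2 * prob {\<omega> \<in> space R. pk_Vn N Ue n \<omega> > u}"
proof -
  have "expectation (pk_W \<rho> N Ue n u)
      = expectation (\<lambda>\<omega>. \<rho>\<^sup>2 * indicator {\<omega> \<in> space R. pk_Vn N Ue n \<omega> > u} \<omega>)"
    by (intro Bochner_Integration.integral_cong) (auto simp: pk_W_def)
  also have "\<dots> = \<rho>\<^sup>2 * prob {\<omega> \<in> space R. pk_Vn N Ue n \<omega> > u}"
    using sets.Int_space_eq2[OF pk_Vn_event[OF assms]] by simp
  finally show ?thesis .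
qed

context
  fixes Q :: "'q measure" and \<kappa> n :: nat and Zs Ws :: "nat \<Rightarrow> 'q \<Rightarrow> real" and u :: real
  assumes Q: "prob_space Q" and u: "0 \<le> u"
    and copies: "iid_pair_copies Q \<kappa> Zs Ws R (pk_Z \<rho> N Ue u) (pk_W \<rho> N Ue n u)"
begin

interpretation Q: prob_space Q by (rule Q)

lemma
  assumes "i < \<kappa>"
  shows measurable_copy_pair: "(\<lambda>\<omega>. (Zs i \<omega>, Ws i \<omega>)) \<in> measurable Q (borel \<Otimes>\<^sub>M borel)"
    and measurable_copy_Z: "Zs i \<in> borel_measurable Q"
    and measurable_copy_W: "Ws i \<in> borel_measurable Q"
proof -
  show *: "(\<lambda>\<omega>. (Zs i \<omega>, Ws i \<omega>)) \<in> measurable Q (borel \<Otimes>\<^sub>M borel)"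
    using copies assms by (auto simp: iid_pair_copies_def Q.indep_vars_def)
  show "Zs i \<in> borel_measurable Q" "Ws i \<in> borel_measurable Q"
    using measurable_compose[OF * measurable_fst] measurable_compose[OF * measurable_snd] by simp_all
qed

lemma distr_copy:
  "i < \<kappa> \<Longrightarrow> distr Q (borel \<Otimes>\<^sub>M borel) (\<lambda>\<omega>. (Zs i \<omega>, Ws i \<omega>))
    = distr R (borel \<Otimes>\<^sub>M borel) (\<lambda>\<omega>. (pk_Z \<rho> N Ue u \<omega>, pk_W \<rho> N Ue n u \<omega>))"
  using copies by (simp add: iid_pair_copies_def)

lemma measurable_pk_pair:
  "(\<lambda>\<omega>. (pk_Z \<rho> N Ue u \<omega>, pk_W \<rho> N Ue n u \<omega>)) \<in> measurable R (borel \<Otimes>\<^sub>M borel)"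
  using measurable_pk_W[OF u] by measurable

lemma prob_copy:
  assumes "i < \<kappa>" and A: "{x. f x \<noteq> 0} \<in> sets (borel \<Otimes>\<^sub>M borel)"
  shows "Q.prob {\<omega> \<in> space Q. f (Zs i \<omega>, Ws i \<omega>) \<noteq> 0}
    = prob {\<omega> \<in> space R. f (pk_Z \<rho> N Ue u \<omega>, pk_W \<rho> N Ue n u \<omega>) \<noteq> (0::real)}"
  using arg_cong[OF distr_copy[OF assms(1)], of "\<lambda>D. measure D {x. f x \<noteq> 0}"]
  by (simp add: measure_distr[OF measurable_copy_pair[OF assms(1)] A] measure_distr[OF measurable_pk_pair A]
      vimage_def Int_def conj_commute)

lemma nonzero_events: "{x. fst x \<noteq> (0::real)} \<in> sets (borel \<Otimes>\<^sub>M (borel :: real measure))"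
  "{x. snd x \<noteq> (0::real)} \<in> sets ((borel :: real measure) \<Otimes>\<^sub>M borel)"
proof -
  have "{x \<in> space (borel \<Otimes>\<^sub>M (borel :: real measure)). fst x \<noteq> (0::real)} \<in> sets (borel \<Otimes>\<^sub>M borel)"
    "{x \<in> space ((borel :: real measure) \<Otimes>\<^sub>M borel). snd x \<noteq> (0::real)} \<in> sets (borel \<Otimes>\<^sub>M borel)"
    by measurable
  then show "{x. fst x \<noteq> (0::real)} \<in> sets (borel \<Otimes>\<^sub>M (borel :: real measure))"
    "{x. snd x \<noteq> (0::real)} \<in> sets ((borel :: real measure) \<Otimes>\<^sub>M borel)"
    by (simp_all add: space_pair_measure)
qed

lemma prob_copy_Z:
  "i < \<kappa> \<Longrightarrow> Q.prob {\<omega> \<in> space Q. Zs i \<omega> \<noteq> 0} = prob {\<omega> \<in> space R. pk_V N Ue \<omega> > u}"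
  using prob_copy[OF _ nonzero_events(1), of i] \<rho>_pos by (simp add: pk_Z_def)

lemma prob_copy_W:
  "i < \<kappa> \<Longrightarrow> Q.prob {\<omega> \<in> space Q. Ws i \<omega> \<noteq> 0} = prob {\<omega> \<in> space R. pk_Vn N Ue n \<omega> > u}"
  using prob_copy[OF _ nonzero_events(2), of i] \<rho>_pos by (simp add: pk_W_def)

text \<open>The implication relates both coordinates, so it is carried over by the joint law: almost
  surely the pair lies in a set of three points that omits (0,
  \<open>\<rho>\<^sup>2\<close>).\<close>

lemma AE_copy:
  assumes "i < \<kappa>"
  shows "AE \<omega> in Q. Zs i \<omega> \<in> {0, \<rho>\<^sup>2} \<and> Ws i \<omega> \<in> {0, \<rho>\<^sup>2} \<and> (Ws i \<omega> \<noteq> 0 \<longrightarrow> Zs i \<omega> \<noteq> 0)"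
proof -
  define B where "B = {x. fst x \<in> {0, \<rho>\<^sup>2} \<and> snd x \<in> {0, \<rho>\<^sup>2} \<and> (snd x \<noteq> 0 \<longrightarrow> fst x \<noteq> (0::real))}"
  have "B = {(0, 0), (\<rho>\<^sup>2, 0), (\<rho>\<^sup>2, \<rho>\<^sup>2)}"
    using \<rho>_pos by (auto simp: B_def)
  then have "B = {0} \<times> {0} \<union> {\<rho>\<^sup>2} \<times> {0} \<union> {\<rho>\<^sup>2} \<times> {\<rho>\<^sup>2}"
    by auto
  moreover have "{0} \<times> {0} \<union> {\<rho>\<^sup>2} \<times> {0} \<union> {\<rho>\<^sup>2} \<times> {\<rho>\<^sup>2} \<in> sets (borel \<Otimes>\<^sub>M (borel :: real measure))"
    by (intro sets.Un pair_measureI) auto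
  ultimately have B: "{x \<in> space (borel \<Otimes>\<^sub>M borel). x \<in> B} \<in> sets (borel \<Otimes>\<^sub>M borel)"
    by (simp only: space_pair_measure space_borel UNIV_Times_UNIV UNIV_I simp_thms Collect_mem_eq)
  have "AE \<omega> in R. (pk_Z \<rho> N Ue u \<omega>, pk_W \<rho> N Ue n u \<omega>) \<in> B"
    using AE_pk_Vn_imp_pk_V[OF u, of n] by eventually_elim (auto simp: B_def pk_Z_def pk_W_def)
  then have "AE x in distr R (borel \<Otimes>\<^sub>M borel) (\<lambda>\<omega>. (pk_Z \<rho> N Ue u \<omega>, pk_W \<rho> N Ue n u \<omega>)). x \<in> B"
    by (subst AE_distr_iff[OF measurable_pk_pair B])
  then have "AE \<omega> in Q. (Zs i \<omega>, Ws i \<omega>) \<in> B"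
    unfolding distr_copy[OF assms, symmetric] by (subst (asm) AE_distr_iff[OF measurable_copy_pair[OF assms] B])
  then show ?thesis
    by (simp add: B_def)
qed

lemma prob_copy_pair_Z:
  assumes "i < \<kappa>" "j < \<kappa>" "i \<noteq> j"
  shows "Q.prob {\<omega> \<in> space Q. Zs i \<omega> \<noteq> 0 \<and> Zs j \<omega> \<noteq> 0} = (prob {\<omega> \<in> space R. pk_V N Ue \<omega> > u})\<^sup>2"
proof -
  define A where "A = {x. fst x \<noteq> (0::real)} \<inter> space (borel \<Otimes>\<^sub>M (borel :: real measure))"
  have pre: "(\<lambda>\<omega>. (Zs k \<omega>, Ws k \<omega>)) -` A \<inter> space Q = {\<omega> \<in> space Q. Zs k \<omega> \<noteq> 0}" for k
    by (auto simp: A_def space_pair_measure)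
  have "Q.prob (\<Inter>k\<in>{i, j}. (\<lambda>\<omega>. (Zs k \<omega>, Ws k \<omega>)) -` A \<inter> space Q)
      = (\<Prod>k\<in>{i, j}. Q.prob ((\<lambda>\<omega>. (Zs k \<omega>, Ws k \<omega>)) -` A \<inter> space Q))"
    using copies assms nonzero_events
    by (intro Q.indep_varsD[where M' = "\<lambda>_. borel \<Otimes>\<^sub>M borel" and I = "{..<\<kappa>}"])
      (auto simp: iid_pair_copies_def A_def)
  also have "(\<Inter>k\<in>{i, j}. (\<lambda>\<omega>. (Zs k \<omega>, Ws k \<omega>)) -` A \<inter> space Q)
      = {\<omega> \<in> space Q. Zs i \<omega> \<noteq> 0 \<and> Zs j \<omega> \<noteq> 0}"
    unfolding pre by auto
  also have "(\<Prod>k\<in>{i, j}. Q.prob ((\<lambda>\<omega>. (Zs k \<omega>, Ws k \<omega>)) -` A \<inter> space Q))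
      = (prob {\<omega> \<in> space R. pk_V N Ue \<omega> > u})\<^sup>2"
    unfolding pre using assms by (simp add: prob_copy_Z power2_eq_square)
  finally show ?thesis .
qed

end

lemma variance_tail_ratio:
  fixes Zs Ws :: "real \<Rightarrow> nat \<Rightarrow> 'q \<Rightarrow> real"
  assumes Q: "prob_space Q" and \<kappa>: "2 \<le> \<kappa>" and n: "1 \<le> n"
    and copies: "\<And>u. iid_pair_copies Q \<kappa> (Zs u) (Ws u) R (pk_Z \<rho> N Ue u) (pk_W \<rho> N Ue n u)"
  shows "((\<lambda>u. prob_space.variance Q (\<lambda>\<omega>. cv_estimator \<kappa> (expectation (pk_W \<rho> N Ue n u))
        (\<lambda>i. Zs u i \<omega>) (\<lambda>i. Ws u i \<omega>)) / tail D u)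
      \<longlongrightarrow> \<rho> ^ 4 / real \<kappa> * (\<rho> ^ (n - 1) * ((1 + real n * (1 - \<rho>)) / (1 - \<rho>)))) at_top"
    and "((\<lambda>u. prob_space.variance Q (\<lambda>\<omega>. sample_mean \<kappa> (\<lambda>i. Zs u i \<omega>)) / tail D u)
      \<longlongrightarrow> \<rho> ^ 4 / real \<kappa> * ((2 - \<rho>) / (1 - \<rho>))) at_top"
proof -
  interpret Q: prob_space Q by (rule Q)
  have a: "0 < \<rho>\<^sup>2" "\<rho> ^ 4 = (\<rho>\<^sup>2)\<^sup>2"
    using \<rho>_pos by simp_all
  define p where "p u = prob {\<omega> \<in> space R. pk_V N Ue \<omega> > u}" for u
  define q where "q u = prob {\<omega> \<in> space R. pk_Vn N Ue n \<omega> > u}" for u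
  note facts = measurable_copy_Z[OF Q _ copies] measurable_copy_W[OF Q _ copies]
    AE_copy[OF Q _ copies] prob_copy_Z[OF Q _ copies, folded p_def]
    prob_copy_W[OF Q _ copies, folded q_def] prob_copy_pair_Z[OF Q _ copies, folded p_def]
  obtain C where C: "\<And>z w p q. (\<And>i. i < \<kappa> \<Longrightarrow> Q.random_variable borel (z i)) \<Longrightarrow>
      (\<And>i. i < \<kappa> \<Longrightarrow> Q.random_variable borel (w i)) \<Longrightarrow>
      (\<And>i. i < \<kappa> \<Longrightarrow>
        AE \<omega> in Q. z i \<omega> \<in> {0, \<rho>\<^sup>2} \<and> w i \<omega> \<in> {0, \<rho>\<^sup>2} \<and> (w i \<omega> \<noteq> 0 \<longrightarrow> z i \<omega> \<noteq> 0)) \<Longrightarrow>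
      (\<And>i. i < \<kappa> \<Longrightarrow> Q.prob {\<omega> \<in> space Q. z i \<omega> \<noteq> 0} = p) \<Longrightarrow>
      (\<And>i. i < \<kappa> \<Longrightarrow> Q.prob {\<omega> \<in> space Q. w i \<omega> \<noteq> 0} = q) \<Longrightarrow>
      (\<And>i j. i < \<kappa> \<Longrightarrow> j < \<kappa> \<Longrightarrow> i \<noteq> j \<Longrightarrow>
        Q.prob {\<omega> \<in> space Q. z i \<omega> \<noteq> 0 \<and> z j \<omega> \<noteq> 0} = p\<^sup>2) \<Longrightarrow>
      \<bar>Q.variance (\<lambda>\<omega>. cv_estimator \<kappa> (\<rho>\<^sup>2 * q) (\<lambda>i. z i \<omega>) (\<lambda>i. w i \<omega>))
        - (\<rho>\<^sup>2)\<^sup>2 / real \<kappa> * (p - q)\<bar> \<le> C * p\<^sup>2"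
    by (rule Q.cv_estimator_variance[OF a(1) \<kappa>]) blast
  show "((\<lambda>u. Q.variance (\<lambda>\<omega>. cv_estimator \<kappa> (expectation (pk_W \<rho> N Ue n u))
        (\<lambda>i. Zs u i \<omega>) (\<lambda>i. Ws u i \<omega>)) / tail D u)
      \<longlongrightarrow> \<rho> ^ 4 / real \<kappa> * (\<rho> ^ (n - 1) * ((1 + real n * (1 - \<rho>)) / (1 - \<rho>)))) at_top"
  proof (rule tendsto_ratio_perturbed)
    show "eventually (\<lambda>u. \<bar>Q.variance (\<lambda>\<omega>. cv_estimator \<kappa> (expectation (pk_W \<rho> N Ue n u))
        (\<lambda>i. Zs u i \<omega>) (\<lambda>i. Ws u i \<omega>)) - \<rho> ^ 4 / real \<kappa> * (p u - q u)\<bar> \<le> C * (p u)\<^sup>2) at_top"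
      using eventually_ge_at_top[of 0]
    proof eventually_elim
      fix u :: real assume u: "0 \<le> u"
      show "\<bar>Q.variance (\<lambda>\<omega>. cv_estimator \<kappa> (expectation (pk_W \<rho> N Ue n u))
        (\<lambda>i. Zs u i \<omega>) (\<lambda>i. Ws u i \<omega>)) - \<rho> ^ 4 / real \<kappa> * (p u - q u)\<bar> \<le> C * (p u)\<^sup>2"
        unfolding integral_pk_W[OF u] q_def[symmetric] a(2)
        by (intro C facts u)
    qed
    show "((\<lambda>u. (p u - q u) / tail D u) \<longlongrightarrow> \<rho> ^ (n - 1) * ((1 + real n * (1 - \<rho>)) / (1 - \<rho>))) at_top"
      unfolding p_def q_def using n by (rule pk_difference_tail_ratio)
    show "((\<lambda>u. p u / tail D u) \<longlongrightarrow> (2 - \<rho>) / (1 - \<rho>)) at_top"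
      unfolding p_def by (rule pk_V_tail_ratio)
  qed (rule E.tail_tendsto_0 E.tail_pos)+
  \<comment> \<open>With a vanishing control variate the default coefficient 0 applies, so the crude
    estimator is the case q = 0 of the same bound, with the same \<open>C\<close>.\<close>
  have mean: "cv_estimator \<kappa> (\<rho>\<^sup>2 * 0) z (\<lambda>i. 0) = sample_mean \<kappa> z" for z
    by (simp add: cv_estimator_def)
  show "((\<lambda>u. Q.variance (\<lambda>\<omega>. sample_mean \<kappa> (\<lambda>i. Zs u i \<omega>)) / tail D u)
      \<longlongrightarrow> \<rho> ^ 4 / real \<kappa> * ((2 - \<rho>) / (1 - \<rho>))) at_top"
  proof (rule tendsto_ratio_perturbed)
    show "eventually (\<lambda>u. \<bar>Q.variance (\<lambda>\<omega>. sample_mean \<kappa> (\<lambda>i. Zs u i \<omega>))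
        - \<rho> ^ 4 / real \<kappa> * (p u - 0)\<bar> \<le> C * (p u)\<^sup>2) at_top"
      using eventually_ge_at_top[of 0]
    proof eventually_elim
      fix u :: real assume u: "0 \<le> u"
      show "\<bar>Q.variance (\<lambda>\<omega>. sample_mean \<kappa> (\<lambda>i. Zs u i \<omega>))
        - \<rho> ^ 4 / real \<kappa> * (p u - 0)\<bar> \<le> C * (p u)\<^sup>2"
        unfolding a(2) mean[symmetric]
      proof (rule C)
        fix i assume "i < \<kappa>"
        then show "AE \<omega> in Q. Zs u i \<omega> \<in> {0, \<rho>\<^sup>2} \<and> (0::real) \<in> {0, \<rho>\<^sup>2} \<and> ((0::real) \<noteq> 0 \<longrightarrow> Zs u i \<omega> \<noteq> 0)"
          using facts(3)[OF u] by (auto elim: AE_mp)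
      qed (use facts u in auto)
    qed
    show "((\<lambda>u. (p u - 0) / tail D u) \<longlongrightarrow> (2 - \<rho>) / (1 - \<rho>)) at_top"
      "((\<lambda>u. p u / tail D u) \<longlongrightarrow> (2 - \<rho>) / (1 - \<rho>)) at_top"
      unfolding p_def using pk_V_tail_ratio by simp_all
  qed (rule E.tail_tendsto_0 E.tail_pos)+
qed

end

theorem theorem3p7:
  fixes \<epsilon> lam \<theta> \<rho> \<mu>B \<mu>C :: real
    and Fp Fh G Fhe Ge :: "real \<Rightarrow> real"
    and S :: "'s set" and P :: "'s \<Rightarrow> 'w measure" and J :: "real \<Rightarrow> 'w \<Rightarrow> 's"
    and \<Delta> :: 's and \<alpha> :: "'s pmf"
    and M :: "'a measure" and A :: "real \<Rightarrow> 'a \<Rightarrow> nat" and U :: "nat \<Rightarrow> 'a \<Rightarrow> real"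
    and MB :: "'d measure" and B :: "'d \<Rightarrow> real"
    and MC :: "'e measure" and C :: "'e \<Rightarrow> real"
    and R :: "'b measure" and N :: "'b \<Rightarrow> nat" and Ue :: "nat \<Rightarrow> 'b \<Rightarrow> real"
    and Q :: "'q measure" and Zs Ws :: "real \<Rightarrow> nat \<Rightarrow> 'q \<Rightarrow> real"
    and \<phi> :: "real \<Rightarrow> real" and zhat est :: "real \<Rightarrow> 'q \<Rightarrow> real"
    and n \<kappa> :: nat
  assumes eps: "0 < \<epsilon>" "\<epsilon> < 1"
    \<comment> \<open>the phase-type variable \<open>B\<close> and the heavy-tailed variable \<open>C\<close>\<close>
    and Fp: "phase_type S P J \<Delta> \<alpha> Fp"
    and B: "prob_space MB" "B \<in> borel_measurable MB" "cdf (distr MB borel B) = Fp"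
      "integrable MB B" "\<mu>B = integral\<^sup>L MB B"
    and Fh: "subexponential Fh"
    and C: "prob_space MC" "C \<in> borel_measurable MC" "cdf (distr MC borel C) = Fh"
      "integrable MC C" "\<mu>C = integral\<^sup>L MC C"
    \<comment> \<open>the risk model\<close>
    and G: "G = (\<lambda>u. (1 - \<epsilon>) * Fp u + \<epsilon> * Fh u)"
    and claims: "compound_poisson_claims M lam A U G"
    and theta: "\<theta> = lam * \<mu>C"
    and rho: "\<rho> = lam * integral\<^sup>L M (U 0)" "\<rho> = (1 - \<epsilon>) * lam * \<mu>B + \<epsilon> * \<theta>"
    and net_profit: "\<rho> < 1"
    and Fhe: "Fhe = excess_df \<mu>C Fh" "subexponential Fhe"
    and Ge: "Ge = excess_df (integral\<^sup>L M (U 0)) G"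
    \<comment> \<open>the simulation\<close>
    and pk: "pk_variables R \<rho> Ge N Ue"
    and n: "n \<ge> 1" and kappa: "\<kappa> \<ge> 2"
    and phi: "\<phi> = (\<lambda>u. integral\<^sup>L R (pk_W \<rho> N Ue n u))"
    and Q: "prob_space Q"
    and copies: "\<And>u. iid_pair_copies Q \<kappa> (Zs u) (Ws u) R (pk_Z \<rho> N Ue u) (pk_W \<rho> N Ue n u)"
    and zhat: "zhat = (\<lambda>u \<omega>. sample_mean \<kappa> (\<lambda>i. Zs u i \<omega>))"
    and est: "est = (\<lambda>u \<omega>. cv_estimator \<kappa> (\<phi> u) (\<lambda>i. Zs u i \<omega>) (\<lambda>i. Ws u i \<omega>))"
  shows "(\<lambda>u. prob_space.variance Q (est u)) \<sim>[at_top]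
           (\<lambda>u. \<rho> ^ (n + 3) * ((1 + real n * (1 - \<rho>)) / (1 - \<rho>)) * (\<epsilon> * \<theta> / \<rho>)
                 * ((1 - Fhe u) / real \<kappa>))
       \<and> ((\<lambda>u. prob_space.variance Q (est u) / prob_space.variance Q (zhat u)) \<longlongrightarrow>
           \<rho> ^ (n - 1) * ((1 + real n * (1 - \<rho>)) / (1 + (1 - \<rho>)))) at_top"
proof -
  interpret pk: pk_variables R \<rho> Ge N Ue by (rule pk)
  interpret compound_poisson_claims M lam A U G by (rule claims)
  define m where "m = (1 - \<epsilon>) * \<mu>B + \<epsilon> * \<mu>C"
  have "lam > 0"
    by (rule rate_pos)
  \<comment> \<open>Equating the two expressions for \<rho> identifies the mean claim size, without
    integrating over the mixture.\<close>
  moreover have "lam * integral\<^sup>L M (U 0) = lam * m"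
    using rho theta by (simp add: m_def algebra_simps)
  ultimately have m: "integral\<^sup>L M (U 0) = m"
    by simp
  note excess = mixture_excess_tail[OF eps Fp B Fh C G Fhe m_def]
  have "0 < \<mu>C" "0 < m"
    by (rule excess)+
  have \<rho>: "\<rho> = lam * m" "0 < \<rho>"
    using rho(1) m \<open>lam > 0\<close> \<open>0 < m\<close> by auto
  \<comment> \<open>The limiting tail ratio of \<open>Ge\<close> to \<open>Fhe\<close>; the rate
    \<open>lam\<close> cancels between \<theta> and \<rho>.\<close>
  define e where "e = \<epsilon> * \<theta> / \<rho>"
  have e: "e = \<epsilon> * \<mu>C / m" "0 < e"
    using \<open>lam > 0\<close> \<open>0 < m\<close> \<open>0 < \<mu>C\<close> eps by (simp_all add: e_def theta \<rho>(1))
  have Ge_tail: "((\<lambda>u. (1 - Ge u) / (1 - Fhe u)) \<longlongrightarrow> e) at_top" "0 < 1 - Ge u" for u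
    unfolding Ge m e using excess by auto

  interpret H: subexponential_distribution "interval_measure Fhe"
    using Fhe(2) by (rule subexponential_imp_subexponential_distribution)
  have H_tail: "tail (interval_measure Fhe) u = 1 - Fhe u" for u
    using Fhe(2) by (rule subexponential_imp_subexponential_distribution)
  have D_cdf: "cdf (distr R borel (Ue 1)) = Ge"
    by (rule pk.excess_distribution) simp
  have "pk.random_variable borel (Ue 1)"
    using pk.excess_indep by (auto simp: pk.indep_vars_def)
  then have "real_distribution (distr R borel (Ue 1))"
    by (rule pk.real_distribution_distr)
  moreover have "cdf (distr R borel (Ue 1)) x = 0" if "x < 0" for x
    unfolding D_cdf using that by (simp add: Ge excess_df_def)
  ultimately have D: "half_line_distribution (distr R borel (Ue 1))"
    by (rule half_line_distributionI)
  have D_tail: "tail (distr R borel (Ue 1)) u = 1 - Ge u" for u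
    unfolding half_line_distribution.tail_eq_cdf[OF D] D_cdf ..
  have "subexponential_distribution (distr R borel (Ue 1))"
    by (rule H.tail_equivalent_subexponential[where c = e]; (unfold D_tail H_tail)?)
      (rule D Ge_tail e)+
  then interpret subexponential_pk R \<rho> Ge N Ue
    using pk \<rho>(2) net_profit
    by (intro subexponential_pk.intro subexponential_pk_axioms.intro)

  define v where "v u = prob_space.variance Q (est u)" for u
  define vz where "vz u = prob_space.variance Q (zhat u)" for u
  define l where "l = \<rho> ^ (n - 1) * ((1 + real n * (1 - \<rho>)) / (1 - \<rho>))"
  have "0 < l"
    using \<rho>(2) net_profit unfolding l_def
    by (intro mult_pos_pos divide_pos_pos add_pos_nonneg) auto
  have "0 < real \<kappa>"
    using kappa by simp
  have v: "((\<lambda>u. v u / (1 - Ge u)) \<longlongrightarrow> \<rho> ^ 4 / real \<kappa> * l) at_top"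
    using variance_tail_ratio(1)[OF Q kappa n copies]
    unfolding v_def est phi l_def D_tail .
  have vz: "((\<lambda>u. vz u / (1 - Ge u)) \<longlongrightarrow> \<rho> ^ 4 / real \<kappa> * ((2 - \<rho>) / (1 - \<rho>))) at_top"
    using variance_tail_ratio(2)[OF Q kappa n copies]
    unfolding vz_def zhat D_tail .
  have Ge_nz: "1 - Ge u \<noteq> 0" and Fhe_nz: "1 - Fhe u \<noteq> 0" for u
    using Ge_tail(2)[of u] H.tail_pos[of u] by (simp_all add: H_tail)

  \<comment> \<open>The hypothesis n \<ge> 1 matters for the truncated n - 1.\<close>
  have pow: "\<rho> ^ (n + 3) = \<rho> ^ 4 * \<rho> ^ (n - 1)"
    using n by (simp add: power_add[symmetric] add.commute)
  define K where "K = \<rho> ^ (n + 3) * ((1 + real n * (1 - \<rho>)) / (1 - \<rho>)) * (\<epsilon> * \<theta> / \<rho>)"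
  have K: "K = \<rho> ^ 4 * l * e"
    unfolding K_def pow l_def e_def by (simp only: mult.assoc)
  have "((\<lambda>u. v u / (1 - Ge u) * ((1 - Ge u) / (1 - Fhe u)) * (real \<kappa> / K))
      \<longlongrightarrow> \<rho> ^ 4 / real \<kappa> * l * e * (real \<kappa> / K)) at_top"
    by (intro tendsto_mult v Ge_tail tendsto_const)
  moreover have "\<rho> ^ 4 / real \<kappa> * l * e * (real \<kappa> / K) = 1"
    using \<open>0 < real \<kappa>\<close> \<open>0 < l\<close> \<rho>(2) e(2) by (simp add: K)
  moreover have "v u / (1 - Ge u) * ((1 - Ge u) / (1 - Fhe u)) * (real \<kappa> / K)
      = v u / (K * ((1 - Fhe u) / real \<kappa>))" for u
    using Ge_nz[of u] by simp
  ultimately have "((\<lambda>u. v u / (K * ((1 - Fhe u) / real \<kappa>))) \<longlongrightarrow> 1) at_top"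
    by simp
  then have "v \<sim>[at_top] (\<lambda>u. K * ((1 - Fhe u) / real \<kappa>))"
    by (rule asymp_equivI')
  moreover have "((\<lambda>u. v u / vz u) \<longlongrightarrow> \<rho> ^ (n - 1) * ((1 + real n * (1 - \<rho>)) / (1 + (1 - \<rho>)))) at_top"
  proof -
    have "((\<lambda>u. (v u / (1 - Ge u)) / (vz u / (1 - Ge u)))
        \<longlongrightarrow> (\<rho> ^ 4 / real \<kappa> * l) / (\<rho> ^ 4 / real \<kappa> * ((2 - \<rho>) / (1 - \<rho>)))) at_top"
      using \<rho> net_profit \<open>0 < real \<kappa>\<close> by (intro tendsto_divide v vz) auto
    moreover have "(v u / (1 - Ge u)) / (vz u / (1 - Ge u)) = v u / vz u" for u
      using Ge_nz[of u] by simp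
    moreover have "(\<rho> ^ 4 / real \<kappa> * l) / (\<rho> ^ 4 / real \<kappa> * ((2 - \<rho>) / (1 - \<rho>)))
        = l / ((2 - \<rho>) / (1 - \<rho>))"
      using \<rho> \<open>0 < real \<kappa>\<close> by (intro nonzero_mult_divide_mult_cancel_left) auto
    moreover have "l / ((2 - \<rho>) / (1 - \<rho>)) = \<rho> ^ (n - 1) * ((1 + real n * (1 - \<rho>)) / (1 + (1 - \<rho>)))"
      using net_profit by (simp add: l_def)
    ultimately show ?thesis
      by (simp only:)
  qed
  ultimately show ?thesis
    unfolding v_def vz_def K_def by blast
qed

end
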